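(* (a) Fix $\epsilon>0$. For all sufficiently large $d$ the following holds: if $n\ge(\pi/4+\epsilon)\,d^2/\log d$ and $u_1,\dots,u_n,v_1,\dots,v_n$ are i.i.d. $\mathcal N(0,I_d/d)$ in $\mathbb R^d$, then with probability at least $1-e^{-\Omega(d)}$ there is no matrix $W\in\mathbb R^{d\times d}$ such that $u_i^\top Wv_i>u_j^\top Wv_i$ for all $i\in[n]$ and all $j\ne i$. (b) More generally, suppose $u_1,\dots,u_n$ are i.i.d. $\mathcal N(0,I_d/d)$ and $v_1,\dots,v_n\in\mathbb R^d\setminus\{0\}$ satisfy, with fixed implicit constants, $\|v_i\|\lesssim 1$ for all $i$, $\frac1n\sum_i v_iv_i^\top\succeq \frac{c}{d}I_d$ for some constant $c>0$, and $\big\|\frac1n\sum_i v_i^{\otimes 4}\big\|\lesssim d^{-2}$. Then there is a constant $C$ (depending only on these implicit constants) such that for all sufficiently large $d$, if $n\ge C\,d^2/\log d$, then with probability at least $1-e^{-\Omega(d)}$ no such $W$ exists.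
   Context: $\|\cdot\|$ on the symmetric 4-tensor $\frac1n\sum_i v_i^{\otimes4}$ denotes the injective (operator) norm $\sup_{\|x\|=1}\frac1n\sum_i\langle v_i,x\rangle^4$. The notation $\lesssim$ means bounded by a fixed constant multiple independent of $n,d$. *)

theory Defs
  imports "HOL-Probability.Probability"
begin

text \<open>Vectors in R^d are modelled as functions nat => real; only coordinates k < d matter.
  Matrices W in R^(d x d) are functions nat => nat => real; only entries j,k < d matter.\<close>

definition dotp :: "nat \<Rightarrow> (nat \<Rightarrow> real) \<Rightarrow> (nat \<Rightarrow> real) \<Rightarrow> real" where
  "dotp d x y = (\<Sum>k<d. x k * y k)"

definition vnorm :: "nat \<Rightarrow> (nat \<Rightarrow> real) \<Rightarrow> real" where
  "vnorm d x = sqrt (dotp d x x)"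

definition bilin :: "nat \<Rightarrow> (nat \<Rightarrow> real) \<Rightarrow> (nat \<Rightarrow> nat \<Rightarrow> real) \<Rightarrow> (nat \<Rightarrow> real) \<Rightarrow> real" where
  "bilin d u W v = (\<Sum>j<d. \<Sum>k<d. u j * W j k * v k)"

definition exists_sep_W :: "nat \<Rightarrow> nat \<Rightarrow> (nat \<Rightarrow> nat \<Rightarrow> real) \<Rightarrow> (nat \<Rightarrow> nat \<Rightarrow> real) \<Rightarrow> bool" where
  "exists_sep_W d n u v =
     (\<exists>W :: nat \<Rightarrow> nat \<Rightarrow> real. \<forall>i<n. \<forall>j<n. j \<noteq> i \<longrightarrow>
         bilin d (u i) W (v i) > bilin d (u j) W (v i))"

text \<open>Law of n i.i.d. N(0, I_d/d) vectors in R^d: the sample is \<omega> with u i k = \<omega> (i,k),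
  all coordinates i.i.d. N(0, 1/d) (standard deviation 1/sqrt d).\<close>
definition gauss_vecs :: "nat \<Rightarrow> nat \<Rightarrow> (nat \<times> nat \<Rightarrow> real) measure" where
  "gauss_vecs d n = PiM ({..<n} \<times> {..<d}) (\<lambda>_. density lborel (normal_density 0 (1 / sqrt (real d))))"

definition vecs_of :: "(nat \<times> nat \<Rightarrow> real) \<Rightarrow> nat \<Rightarrow> nat \<Rightarrow> real" where
  "vecs_of \<omega> i k = \<omega> (i, k)"

text \<open>Injective norm of the symmetric 4-tensor (1/n) sum_i v_i^{\<otimes>4}.\<close>
definition tensor4_norm :: "nat \<Rightarrow> nat \<Rightarrow> (nat \<Rightarrow> nat \<Rightarrow> real) \<Rightarrow> real" where
  "tensor4_norm d n v =
     (SUP x\<in>{x. vnorm d x = 1}. (1 / real n) * (\<Sum>i<n. (dotp d (v i) x) ^ 4))"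

end

theory Submission
  imports Defs "HOL-Real_Asymp.Real_Asymp"
begin

text \<open>
  Suppose that \<open>W\<close> separates. Summing the inequalities over \<open>i\<close> gives
  \<open>\<langle>W, \<Sum>\<^sub>i u\<^sub>i v\<^sub>i\<^sup>T\<rangle> \<ge> \<Sum>\<^sub>i max\<^sub>j \<langle>u\<^sub>j, W v\<^sub>i\<rangle>\<close>. With probability \<open>1 - e\<^sup>-\<^sup>\<Omega>\<^sup>(\<^sup>d\<^sup>)\<close>:

  \<^item> \<open>max\<^sub>j \<langle>u\<^sub>j, x\<rangle> \<ge> (1 - o(1)) sqrt (2 log d / d) \<parallel>x\<parallel>\<close> uniformly in \<open>x\<close>. Even a polynomially fine
    net, of size \<open>exp (O(d log d))\<close>, suffices, because for a single \<open>x\<close> the failure probability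
    is \<open>exp (- d\<^sup>1\<^sup>+\<^sup>\<eta>)\<close> for some \<open>\<eta> > 0\<close>.
  \<^item> \<open>\<parallel>\<Sum>\<^sub>i u\<^sub>i v\<^sub>i\<^sup>T\<parallel>\<^sub>F\<^sup>2 \<le> (1 + \<delta>) \<Sum>\<^sub>i \<parallel>v\<^sub>i\<parallel>\<^sup>2\<close>, since given the \<open>v\<^sub>i\<close> each column of this matrix is an
    isotropic Gaussian vector.

  Writing \<open>w\<^sub>r\<close> for the rows of \<open>W\<close>, Cauchy-Schwarz gives
  \<open>\<parallel>W\<parallel>\<^sub>F \<parallel>W v\<parallel> \<ge> \<Sum>\<^sub>r \<parallel>w\<^sub>r\<parallel> \<bar>\<langle>w\<^sub>r, v\<rangle>\<bar>\<close>, so a bound \<open>\<Sum>\<^sub>i \<bar>\<langle>v\<^sub>i, x\<rangle>\<bar> \<ge> (n \<beta> / sqrt d) \<parallel>x\<parallel>\<close> for all vectors \<open>x\<close>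
  already yields \<open>\<Sum>\<^sub>i \<parallel>W v\<^sub>i\<parallel> \<ge> (n \<beta> / sqrt d) \<parallel>W\<parallel>\<^sub>F\<close>; this avoids a net over the \<open>d\<^sup>2\<close>-dimensional
  space of matrices. If \<open>\<Sum>\<^sub>i \<parallel>v\<^sub>i\<parallel>\<^sup>2 \<le> n S\<close>, comparing both sides yields a contradiction as soon as
  \<open>n \<ge> \<gamma> d\<^sup>2 / log d\<close> with \<open>2 \<beta>\<^sup>2 \<gamma> > S\<close>. For Gaussian \<open>v\<^sub>i\<close> one may take \<open>S\<close> close to \<open>1\<close> and \<open>\<beta>\<^sup>2\<close> close
  to \<open>2 / \<pi>\<close>, which is the threshold \<open>\<pi> / 4\<close>; under the hypotheses of (b) some \<open>\<beta> > 0\<close> is obtained from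
  the second and fourth moments.
\<close>

section \<open>Independent standard normal variables\<close>

text \<open>Markov's inequality in product form: the indicator of \<open>A\<close> is at most the
  product of the \<open>g (Y j \<omega>)\<close>, and by independence the expectation of that
  product factorizes. With \<open>g\<close> an exponential tilt this is the Chernoff bound; with
  \<open>g\<close> the indicator of a half-line it controls the maximum of the family.\<close>

lemma (in prob_space) prob_le_prod_std_normal:
  fixes Y :: "'j \<Rightarrow> 'a \<Rightarrow> real" and g :: "real \<Rightarrow> real"
  assumes J: "finite J" and ind: "indep_vars (\<lambda>_. borel) Y J"
    and dist: "\<And>j. j \<in> J \<Longrightarrow> distributed M lborel (Y j) std_normal_density"
    and g: "g \<in> borel_measurable borel" "\<And>x. 0 \<le> g x"
    and A: "A \<in> events" "\<And>\<omega>. \<omega> \<in> A \<Longrightarrow> 1 \<le> (\<Prod>j\<in>J. g (Y j \<omega>))"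
    and B: "(\<integral>\<^sup>+x. ennreal (std_normal_density x * g x) \<partial>lborel) \<le> ennreal B" "0 \<le> B"
  shows "prob A \<le> B ^ card J"
proof -
  have "emeasure M A = (\<integral>\<^sup>+\<omega>. indicator A \<omega> \<partial>M)"
    using A by simp
  also have "\<dots> \<le> (\<integral>\<^sup>+\<omega>. (\<Prod>j\<in>J. ennreal (g (Y j \<omega>))) \<partial>M)"
    using A g by (intro nn_integral_mono) (auto simp: indicator_def prod_ennreal)
  also have "\<dots> = (\<Prod>j\<in>J. \<integral>\<^sup>+\<omega>. ennreal (g (Y j \<omega>)) \<partial>M)"
    using g by (intro indep_vars_nn_integral J indep_vars_compose2[OF ind]) auto
  also have "\<dots> = (\<Prod>j\<in>J. \<integral>\<^sup>+x. ennreal (std_normal_density x * g x) \<partial>lborel)"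
  proof (intro prod.cong refl)
    fix j assume "j \<in> J"
    then show "(\<integral>\<^sup>+\<omega>. ennreal (g (Y j \<omega>)) \<partial>M) = (\<integral>\<^sup>+x. ennreal (std_normal_density x * g x) \<partial>lborel)"
      using distributed_nn_integral[OF dist, of j "\<lambda>x. ennreal (g x)"] g
      by (simp add: ennreal_mult)
  qed
  also have "\<dots> \<le> (\<Prod>j\<in>J. ennreal B)"
    by (intro prod_mono_ennreal B)
  also have "\<dots> = ennreal (B ^ card J)"
    using B by (simp add: ennreal_power)
  finally show ?thesis
    using B by (simp add: emeasure_eq_measure)
qed

text \<open>The factor \<delta> / (2 (1 + \<delta>)) is the optimal Chernoff tilt for the event that
  a mean of squares exceeds 1 + \<delta>. It turns the density into a constant multiple of the N(0,
  1 + \<delta>) density, so the integral is exactly that constant.\<close>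

lemma std_normal_exp_square:
  fixes \<delta> :: real
  assumes "0 < \<delta>"
  shows "(\<integral>\<^sup>+x. ennreal (std_normal_density x * exp (\<delta> / (2 * (1 + \<delta>)) * (x\<^sup>2 - (1 + \<delta>)))) \<partial>lborel)
    = ennreal (exp (- (\<delta> - ln (1 + \<delta>)) / 2))"
proof -
  define s where "s = sqrt (1 + \<delta>)"
  have s: "s > 0" "s\<^sup>2 = 1 + \<delta>" using assms by (auto simp: s_def)
  have ss: "s = exp (ln (1 + \<delta>) / 2)"
    using assms by (simp add: s_def ln_sqrt[symmetric])
  have eq: "std_normal_density x * exp (\<delta> / (2 * (1 + \<delta>)) * (x\<^sup>2 - (1 + \<delta>)))
      = exp (- (\<delta> - ln (1 + \<delta>)) / 2) * normal_density 0 s x" for x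
  proof -
    have "exp (- (\<delta> - ln (1 + \<delta>)) / 2) * normal_density 0 s x
        = exp (-\<delta>/2) * s * (1 / (sqrt (2 * pi) * s)) * exp (- x\<^sup>2 / (2 * (1+\<delta>)))"
    proof -
      have "exp (- (\<delta> - ln (1 + \<delta>)) / 2) = exp (-\<delta>/2 + ln (1 + \<delta>) / 2)"
        by (rule arg_cong[where f=exp]) simp
      then have "exp (- (\<delta> - ln (1 + \<delta>)) / 2) = exp (-\<delta>/2) * s"
        by (simp only: exp_add ss[symmetric])
      then show ?thesis
        using s by (simp add: normal_density_def s(2) real_sqrt_mult s_def[symmetric])
    qed
    also have "\<dots> = 1 / sqrt (2 * pi) * (exp (-\<delta>/2) * exp (- x\<^sup>2 / (2 * (1+\<delta>))))"
      using s by simp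
    also have "exp (-\<delta>/2) * exp (- x\<^sup>2 / (2 * (1+\<delta>))) = exp (- x\<^sup>2/2) * exp (\<delta> / (2 * (1 + \<delta>)) * (x\<^sup>2 - (1 + \<delta>)))"
    proof -
      have "-\<delta>/2 + (- x\<^sup>2 / (2 * (1+\<delta>))) = - x\<^sup>2/2 + \<delta> / (2 * (1 + \<delta>)) * (x\<^sup>2 - (1 + \<delta>))"
        using assms by (simp add: divide_simps) (simp add: algebra_simps)
      then show ?thesis by (simp only: exp_add[symmetric])
    qed
    finally show ?thesis by (simp add: std_normal_density_def)
  qed
  have "(\<integral>\<^sup>+x. ennreal (normal_density 0 s x) \<partial>lborel) = 1"
    using s by (simp add: nn_integral_eq_integral)
  then show ?thesis
    unfolding eq by (simp add: ennreal_mult nn_integral_cmult)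
qed

text \<open>Since exp(-y) <= 1 - y + y^2/2 for y >= 0, only the moments E|X| = sqrt(2/pi) and E X^2
  = 1 enter. The choice of \<open>s\<close> minimizes the resulting exponent - s \<delta> sqrt(2/pi)
  + s^2/2.\<close>

lemma std_normal_exp_abs:
  fixes \<delta> :: real
  assumes "0 < \<delta>"
  defines "s \<equiv> \<delta> * sqrt (2/pi)"
  shows "(\<integral>\<^sup>+x. ennreal (std_normal_density x * exp (s * ((1 - \<delta>) * sqrt (2/pi) - \<bar>x\<bar>))) \<partial>lborel)
    \<le> ennreal (exp (- \<delta>\<^sup>2 / pi))"
proof -
  define m where "m = sqrt (2/pi)"
  have m: "m > 0" "m\<^sup>2 = 2/pi" by (auto simp: m_def)
  have s: "s > 0" using assms by (auto simp: s_def)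
  have ineq: "exp (- s * \<bar>x\<bar>) \<le> 1 - s * \<bar>x\<bar> + s\<^sup>2 / 2 * x\<^sup>2" for x :: real
  proof -
    have "exp (-y) \<le> 1 - y + y\<^sup>2 / 2" if "y \<ge> 0" for y :: real
    proof -
      define f where "f = (\<lambda>y::real. 1 - y + y\<^sup>2 / 2 - exp (-y))"
      have "f 0 \<le> f y"
      proof (rule DERIV_nonneg_imp_nondecreasing[OF that])
        fix x :: real assume "0 \<le> x"
        have "(f has_real_derivative (x - 1 + exp (-x))) (at x)"
          unfolding f_def by (auto intro!: derivative_eq_intros)
        moreover have "x - 1 + exp (-x) \<ge> 0" using exp_ge_add_one_self[of "-x"] by linarith
        ultimately show "\<exists>D. (f has_real_derivative D) (at x) \<and> 0 \<le> D" by blast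
      qed
      then show ?thesis by (simp add: f_def)
    qed
    from this[of "s * \<bar>x\<bar>"] s show ?thesis by (simp add: power_mult_distrib)
  qed
  define E where "E = exp (s * ((1 - \<delta>) * m))"
  let ?f = "\<lambda>x. E * (std_normal_density x - s * (std_normal_density x * \<bar>x\<bar>) + s\<^sup>2 / 2 * (std_normal_density x * x\<^sup>2))"
  have hb: "has_bochner_integral lborel ?f (E * (1 - s * m + s\<^sup>2 / 2 * 1))"
  proof (intro has_bochner_integral_mult_right has_bochner_integral_add has_bochner_integral_diff)
    show "has_bochner_integral lborel std_normal_density 1"
      by (simp add: has_bochner_integral_iff)
    show "has_bochner_integral lborel (\<lambda>x. std_normal_density x * \<bar>x\<bar>) m"
      using std_normal_moment_abs_odd[of 0] by (simp add: m_def)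
    show "has_bochner_integral lborel (\<lambda>x. std_normal_density x * x\<^sup>2) 1"
      using std_normal_moment_even[of 1] by simp
  qed
  have le: "std_normal_density x * exp (s * ((1 - \<delta>) * sqrt (2/pi) - \<bar>x\<bar>)) \<le> ?f x" for x
  proof -
    have "exp (s * ((1 - \<delta>) * sqrt (2/pi) - \<bar>x\<bar>)) = E * exp (- s * \<bar>x\<bar>)"
      by (simp add: E_def m_def algebra_simps exp_add[symmetric])
    then have "std_normal_density x * exp (s * ((1 - \<delta>) * sqrt (2/pi) - \<bar>x\<bar>)) = E * (std_normal_density x * exp (- s * \<bar>x\<bar>))"
      by simp
    also have "\<dots> \<le> E * (std_normal_density x * (1 - s * \<bar>x\<bar> + s\<^sup>2 / 2 * x\<^sup>2))"
      using ineq[of x] by (intro mult_left_mono) (auto simp: E_def)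
    finally show ?thesis by (simp add: algebra_simps)
  qed
  have "(\<integral>\<^sup>+x. ennreal (std_normal_density x * exp (s * ((1 - \<delta>) * sqrt (2/pi) - \<bar>x\<bar>))) \<partial>lborel)
      \<le> (\<integral>\<^sup>+x. ennreal (?f x) \<partial>lborel)"
    by (intro nn_integral_mono ennreal_leI le)
  also have "\<dots> = ennreal (E * (1 - s * m + s\<^sup>2 / 2 * 1))"
  proof -
    have "0 \<le> std_normal_density x * exp (s * ((1 - \<delta>) * sqrt (2/pi) - \<bar>x\<bar>))" for x by simp
    then have "0 \<le> ?f x" for x using le[of x] by (meson order_trans)
    then show ?thesis
      using hb by (subst nn_integral_eq_integral) (auto simp: has_bochner_integral_iff)
  qed
  also have "\<dots> \<le> ennreal (E * exp (- s * m + s\<^sup>2 / 2))"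
    using exp_ge_add_one_self[of "- s * m + s\<^sup>2 / 2"]
    by (intro ennreal_leI mult_left_mono) (auto simp: E_def algebra_simps)
  also have "E * exp (- s * m + s\<^sup>2 / 2) = exp (s * ((1 - \<delta>) * m) + (- s * m + s\<^sup>2 / 2))"
    by (simp add: E_def exp_add)
  also have "s * ((1 - \<delta>) * m) + (- s * m + s\<^sup>2 / 2) = - \<delta>\<^sup>2 * m\<^sup>2 / 2"
    by (simp add: s_def m_def[symmetric] power2_eq_square algebra_simps)
  also have "\<dots> = - \<delta>\<^sup>2 / pi" by (simp add: m)
  finally show ?thesis .
qed

text \<open>The mass beyond t is at least that of the unit interval from t to t + 1, where the
  density is at least its value q at t + 1; then 1 - q <= exp(-q). Having t + 1 in place of t costs
  nothing later, where t is of order sqrt(ln d).\<close>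

lemma std_normal_le_bound:
  fixes t :: real
  assumes "0 \<le> t"
  shows "(\<integral>\<^sup>+x. ennreal (std_normal_density x * indicator {..t} x) \<partial>lborel)
    \<le> ennreal (exp (- (exp (- (t + 1)\<^sup>2 / 2) / sqrt (2 * pi))))"
proof -
  define q where "q = exp (- (t + 1)\<^sup>2 / 2) / sqrt (2 * pi)"
  have int: "integrable lborel (\<lambda>x. std_normal_density x * indicator A x)" if "A \<in> sets borel" for A
    using integrable_mult_indicator[of A lborel std_normal_density] that by (simp add: mult.commute)
  have 1: "(LINT x|lborel. std_normal_density x * indicator {..t} x) +
       (LINT x|lborel. std_normal_density x * indicator {t<..} x) = 1"
  proof -
    have "(LINT x|lborel. std_normal_density x * indicator {..t} x) +
       (LINT x|lborel. std_normal_density x * indicator {t<..} x)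
       = (LINT x|lborel. std_normal_density x * indicator {..t} x + std_normal_density x * indicator {t<..} x)"
      by (intro Bochner_Integration.integral_add[symmetric] int) auto
    also have "\<dots> = (LINT x|lborel. std_normal_density x)"
      by (intro Bochner_Integration.integral_cong) (auto simp: indicator_def)
    finally show ?thesis by simp
  qed
  have "q = (LINT x|lborel. q * indicator {t<..t+1} x)" by simp
  also have "\<dots> \<le> (LINT x|lborel. std_normal_density x * indicator {t<..} x)"
  proof (intro integral_mono int)
    show "integrable lborel (\<lambda>x. q * indicator {t<..t + 1} x)" by simp
    fix x
    have "q \<le> std_normal_density x" if "t < x" "x \<le> t + 1"
    proof -
      have "x\<^sup>2 \<le> (t+1)\<^sup>2" using that assms by (intro power_mono) auto
      then show ?thesis by (simp add: q_def std_normal_density_def divide_right_mono)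
    qed
    then show "q * indicator {t<..t + 1} x \<le> std_normal_density x * indicator {t<..} x"
      by (auto simp: indicator_def)
  qed auto
  finally have "(LINT x|lborel. std_normal_density x * indicator {..t} x) \<le> 1 - q" using 1 by simp
  also have "\<dots> \<le> exp (-q)" using exp_ge_add_one_self[of "-q"] by simp
  finally show ?thesis
    using int by (subst nn_integral_eq_integral) (auto simp: q_def intro!: ennreal_leI)
qed

section \<open>Tail bounds for independent standard normal families\<close>

lemma (in prob_space) std_normal_sum_squares_tail:
  fixes Y :: "'j \<Rightarrow> 'a \<Rightarrow> real" and \<delta> :: real
  assumes J: "finite J" and ind: "indep_vars (\<lambda>_. borel) Y J"
    and dist: "\<And>j. j \<in> J \<Longrightarrow> distributed M lborel (Y j) std_normal_density"
    and \<delta>: "0 < \<delta>"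
  shows "prob {\<omega> \<in> space M. (1 + \<delta>) * card J \<le> (\<Sum>j\<in>J. (Y j \<omega>)\<^sup>2)} \<le> exp (- ((\<delta> - ln (1 + \<delta>)) / 2) * card J)"
proof -
  have [measurable]: "Y j \<in> borel_measurable M" if "j \<in> J" for j
    using ind that by (auto simp: indep_vars_def)
  define l where "l = \<delta> / (2 * (1 + \<delta>))"
  have l: "l > 0" using \<delta> by (simp add: l_def)
  have "prob {\<omega> \<in> space M. (1 + \<delta>) * card J \<le> (\<Sum>j\<in>J. (Y j \<omega>)\<^sup>2)}
     \<le> exp (- (\<delta> - ln (1 + \<delta>)) / 2) ^ card J"
  proof (rule prob_le_prod_std_normal[OF J ind dist, where g = "\<lambda>x. exp (l * (x\<^sup>2 - (1 + \<delta>)))"])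
    show "(\<integral>\<^sup>+x. ennreal (std_normal_density x * exp (l * (x\<^sup>2 - (1 + \<delta>)))) \<partial>lborel) \<le> ennreal (exp (- (\<delta> - ln (1 + \<delta>)) / 2))"
      using std_normal_exp_square[OF \<delta>] by (simp add: l_def)
    fix \<omega> assume "\<omega> \<in> {\<omega> \<in> space M. (1 + \<delta>) * card J \<le> (\<Sum>j\<in>J. (Y j \<omega>)\<^sup>2)}"
    then have "0 \<le> l * (\<Sum>j\<in>J. ((Y j \<omega>)\<^sup>2 - (1 + \<delta>)))"
      using l by (simp add: sum_subtractf mult.commute)
    then show "1 \<le> (\<Prod>j\<in>J. exp (l * ((Y j \<omega>)\<^sup>2 - (1 + \<delta>))))"
      by (simp add: exp_sum[OF J, symmetric] sum_distrib_left)
  qed auto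
  also have "\<dots> = exp (- ((\<delta> - ln (1 + \<delta>)) / 2) * card J)"
    by (simp add: exp_of_nat_mult[symmetric] field_simps)
  finally show ?thesis .
qed

lemma (in prob_space) std_normal_sum_abs_tail:
  fixes Y :: "'j \<Rightarrow> 'a \<Rightarrow> real" and \<delta> :: real
  assumes J: "finite J" and ind: "indep_vars (\<lambda>_. borel) Y J"
    and dist: "\<And>j. j \<in> J \<Longrightarrow> distributed M lborel (Y j) std_normal_density"
    and \<delta>: "0 < \<delta>"
  shows "prob {\<omega> \<in> space M. (\<Sum>j\<in>J. \<bar>Y j \<omega>\<bar>) \<le> (1 - \<delta>) * sqrt (2 / pi) * card J} \<le> exp (- (\<delta>\<^sup>2 / pi) * card J)"
proof -
  have [measurable]: "Y j \<in> borel_measurable M" if "j \<in> J" for j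
    using ind that by (auto simp: indep_vars_def)
  define s where "s = \<delta> * sqrt (2/pi)"
  have s: "s > 0" using \<delta> by (simp add: s_def)
  have "prob {\<omega> \<in> space M. (\<Sum>j\<in>J. \<bar>Y j \<omega>\<bar>) \<le> (1 - \<delta>) * sqrt (2 / pi) * card J}
     \<le> exp (- \<delta>\<^sup>2 / pi) ^ card J"
  proof (rule prob_le_prod_std_normal[OF J ind dist, where g = "\<lambda>x. exp (s * ((1 - \<delta>) * sqrt (2/pi) - \<bar>x\<bar>))"])
    show "(\<integral>\<^sup>+x. ennreal (std_normal_density x * exp (s * ((1 - \<delta>) * sqrt (2/pi) - \<bar>x\<bar>))) \<partial>lborel) \<le> ennreal (exp (- \<delta>\<^sup>2 / pi))"
      using std_normal_exp_abs[OF \<delta>] by (simp only: s_def)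
    fix \<omega> assume "\<omega> \<in> {\<omega> \<in> space M. (\<Sum>j\<in>J. \<bar>Y j \<omega>\<bar>) \<le> (1 - \<delta>) * sqrt (2 / pi) * card J}"
    then have "0 \<le> s * (\<Sum>j\<in>J. ((1 - \<delta>) * sqrt (2/pi) - \<bar>Y j \<omega>\<bar>))"
      using s by (simp add: sum_subtractf mult.commute)
    then show "1 \<le> (\<Prod>j\<in>J. exp (s * ((1 - \<delta>) * sqrt (2/pi) - \<bar>Y j \<omega>\<bar>)))"
      by (simp only: exp_sum[OF J, symmetric] sum_distrib_left) simp
  qed auto
  also have "\<dots> = exp (- (\<delta>\<^sup>2 / pi) * card J)"
    by (simp add: exp_of_nat_mult[symmetric] mult.commute)
  finally show ?thesis .
qed

lemma (in prob_space) std_normal_max_tail: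
  fixes Y :: "'j \<Rightarrow> 'a \<Rightarrow> real"
  assumes J: "finite J" and ind: "indep_vars (\<lambda>_. borel) Y J"
    and dist: "\<And>j. j \<in> J \<Longrightarrow> distributed M lborel (Y j) std_normal_density"
    and t: "0 \<le> t"
  shows "prob {\<omega> \<in> space M. \<forall>j\<in>J. Y j \<omega> \<le> t} \<le> exp (- (exp (- (t + 1)\<^sup>2 / 2) / sqrt (2 * pi)) * card J)"
proof -
  have [measurable]: "Y j \<in> borel_measurable M" if "j \<in> J" for j
    using ind that by (auto simp: indep_vars_def)
  have "prob {\<omega> \<in> space M. \<forall>j\<in>J. Y j \<omega> \<le> t}
     \<le> exp (- (exp (- (t + 1)\<^sup>2 / 2) / sqrt (2 * pi))) ^ card J"
  proof (rule prob_le_prod_std_normal[OF J ind dist, where g = "indicator {..t}"])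
    show "{\<omega> \<in> space M. \<forall>j\<in>J. Y j \<omega> \<le> t} \<in> events"
      using J by measurable
    show "(\<integral>\<^sup>+x. ennreal (std_normal_density x * indicator {..t} x) \<partial>lborel)
       \<le> ennreal (exp (- (exp (- (t + 1)\<^sup>2 / 2) / sqrt (2 * pi))))"
      using std_normal_le_bound[OF t] by simp
  qed auto
  also have "\<dots> = exp (- (exp (- (t + 1)\<^sup>2 / 2) / sqrt (2 * pi)) * card J)"
    by (simp add: exp_of_nat_mult[symmetric] mult.commute)
  finally show ?thesis .
qed

section \<open>Linear forms under a Gaussian product measure\<close>

definition normal_PiM :: "'i set \<Rightarrow> real \<Rightarrow> ('i \<Rightarrow> real) measure" where
  "normal_PiM I \<sigma> = PiM I (\<lambda>_. density lborel (normal_density 0 \<sigma>))"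

lemma prob_space_normal_PiM: "0 < \<sigma> \<Longrightarrow> prob_space (normal_PiM I \<sigma>)"
  unfolding normal_PiM_def by (intro prob_space_PiM prob_space_normal_density)

lemma measurable_normal_PiM_component [measurable]:
  "i \<in> I \<Longrightarrow> (\<lambda>\<omega>. \<omega> i) \<in> borel_measurable (normal_PiM I \<sigma>)"
  unfolding normal_PiM_def
  using measurable_component_singleton[of i I "\<lambda>_. density lborel (normal_density 0 \<sigma>)"] by simp

lemma distributed_normal_PiM_component:
  assumes "0 < \<sigma>" "i \<in> I"
  shows "distributed (normal_PiM I \<sigma>) lborel (\<lambda>\<omega>. \<omega> i) (normal_density 0 \<sigma>)"
proof -
  have "distr (normal_PiM I \<sigma>) (density lborel (normal_density 0 \<sigma>)) (\<lambda>\<omega>. \<omega> i) = density lborel (normal_density 0 \<sigma>)"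
    unfolding normal_PiM_def using assms
    by (intro distr_PiM_component prob_space_normal_density)
  then have "distr (normal_PiM I \<sigma>) lborel (\<lambda>\<omega>. \<omega> i) = density lborel (normal_density 0 \<sigma>)"
    by (subst distr_cong[where L = "density lborel (normal_density 0 \<sigma>)" and g="\<lambda>\<omega>. \<omega> i"]) auto
  then show ?thesis
    using assms by (simp add: distributed_def)
qed

lemma indep_vars_normal_PiM:
  assumes \<sigma>: "0 < \<sigma>"
  shows "prob_space.indep_vars (normal_PiM I \<sigma>) (\<lambda>_. borel) (\<lambda>i \<omega>. \<omega> i) I"
proof -
  interpret prob_space "normal_PiM I \<sigma>" by (rule prob_space_normal_PiM[OF \<sigma>])
  show ?thesis
  proof (cases "I = {}")
    case True
    then show ?thesis unfolding indep_vars_def indep_sets_def by blast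
  next
    case False
    let ?N = "density lborel (normal_density 0 \<sigma>)"
    have c: "distr (normal_PiM I \<sigma>) borel (\<lambda>\<omega>. \<omega> i) = ?N" if "i \<in> I" for i
    proof -
      have "distr (normal_PiM I \<sigma>) lborel (\<lambda>\<omega>. \<omega> i) = ?N"
        by (rule distributed_distr_eq_density[OF distributed_normal_PiM_component[OF \<sigma> that]])
      moreover have "distr (normal_PiM I \<sigma>) borel (\<lambda>\<omega>. \<omega> i) = distr (normal_PiM I \<sigma>) lborel (\<lambda>\<omega>. \<omega> i)"
        by (rule distr_cong) auto
      ultimately show ?thesis by (rule trans[rotated])
    qed
    \<comment> \<open>Independence is read off from the joint law: the map collecting all
      coordinates is the identity, so it suffices that the measure is the product of its own
      marginals.\<close>
    have "distr (normal_PiM I \<sigma>) (Pi\<^sub>M I (\<lambda>_. borel)) (\<lambda>x. \<lambda>i\<in>I. x i) = distr (normal_PiM I \<sigma>) (normal_PiM I \<sigma>) (\<lambda>x. x)"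
    proof (rule distr_cong)
      show "sets (Pi\<^sub>M I (\<lambda>_. borel)) = sets (normal_PiM I \<sigma>)"
        unfolding normal_PiM_def by (intro sets_PiM_cong) auto
      show "(\<lambda>i\<in>I. x i) = x" if "x \<in> space (normal_PiM I \<sigma>)" for x
        using that unfolding normal_PiM_def by (auto simp: space_PiM PiE_def extensional_restrict)
    qed auto
    also have "\<dots> = normal_PiM I \<sigma>" by simp
    also have "\<dots> = (\<Pi>\<^sub>M i\<in>I. distr (normal_PiM I \<sigma>) borel (\<lambda>\<omega>. \<omega> i))"
      unfolding normal_PiM_def[of I \<sigma>] 
      by (intro PiM_cong refl) (simp add: c[unfolded normal_PiM_def])
    finally show ?thesis
      using False by (subst indep_vars_iff_distr_eq_PiM') auto
  qed
qed

text \<open>Forms supported on disjoint blocks of coordinates are independent, and each is a sum of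
  independent Gaussians with total variance \<sigma>^2 s^2. Rows, columns and single entries as
  blocks yield the three Gaussian families needed below.\<close>

lemma normal_PiM_linear_forms:
  fixes a :: "'i \<Rightarrow> real" and K :: "'j \<Rightarrow> 'i set"
  assumes I: "finite I" and \<sigma>: "0 < \<sigma>"
    and K: "\<And>j. j \<in> J \<Longrightarrow> K j \<subseteq> I" "disjoint_family_on K J"
    and s: "0 < s" "\<And>j. j \<in> J \<Longrightarrow> (\<Sum>p\<in>K j. (a p)\<^sup>2) = s\<^sup>2"
  defines "Y \<equiv> \<lambda>j \<omega>. (\<Sum>p\<in>K j. a p * \<omega> p) / (\<sigma> * s)"
  shows "prob_space.indep_vars (normal_PiM I \<sigma>) (\<lambda>_. borel) Y J"
    and "j \<in> J \<Longrightarrow> distributed (normal_PiM I \<sigma>) lborel (Y j) std_normal_density"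
proof -
  interpret prob_space "normal_PiM I \<sigma>" by (rule prob_space_normal_PiM[OF \<sigma>])
  have 1: "indep_vars (\<lambda>j. PiM (K j) (\<lambda>_. borel)) (\<lambda>j \<omega>. restrict (\<lambda>i. \<omega> i) (K j)) J"
    by (rule indep_vars_restrict[OF indep_vars_normal_PiM[OF \<sigma>] K])
  have "indep_vars (\<lambda>_. borel) (\<lambda>j \<omega>. (\<Sum>p\<in>K j. a p * (restrict (\<lambda>i. \<omega> i) (K j)) p) / (\<sigma> * s)) J"
    by (rule indep_vars_compose2[OF 1]) measurable
  then show "indep_vars (\<lambda>_. borel) Y J"
    unfolding Y_def by (rule iffD1[OF indep_vars_cong, rotated -1]) (auto intro!: ext sum.cong arg_cong[where f="\<lambda>x. x / _"])
  assume j: "j \<in> J"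
  \<comment> \<open>Zero coefficients are dropped because each summand must have positive standard
    deviation. As s > 0, some coefficient remains.\<close>
  define L where "L = {p \<in> K j. a p \<noteq> 0}"
  have fK: "finite (K j)" using K(1)[OF j] I by (rule finite_subset)
  have L: "finite L" "L \<subseteq> I" using K(1)[OF j] I fK by (auto simp: L_def)
  have sL: "(\<Sum>p\<in>L. (a p)\<^sup>2) = s\<^sup>2"
    unfolding s(2)[OF j, symmetric] L_def using fK by (intro sum.mono_neutral_left) auto
  then have "L \<noteq> {}" using s by auto
  have iL: "indep_vars (\<lambda>_. borel) (\<lambda>p \<omega>. a p * \<omega> p) L"
    by (rule indep_vars_compose2[OF indep_vars_subset[OF indep_vars_normal_PiM[OF \<sigma>] L(2)]]) auto
  have "distributed (normal_PiM I \<sigma>) lborel (\<lambda>\<omega>. \<Sum>p\<in>L. a p * \<omega> p)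
      (normal_density (\<Sum>p\<in>L. 0) (sqrt (\<Sum>p\<in>L. (\<bar>a p\<bar> * \<sigma>)\<^sup>2)))"
  proof (rule sum_indep_normal[OF L(1) \<open>L \<noteq> {}\<close> iL])
    fix p assume p: "p \<in> L"
    then show "0 < \<bar>a p\<bar> * \<sigma>" using \<sigma> by (auto simp: L_def)
    have "p \<in> I" using p L by auto
    from normal_density_affine[OF distributed_normal_PiM_component[OF \<sigma> this] \<sigma>, of "a p" 0] p
    show "distributed (normal_PiM I \<sigma>) lborel (\<lambda>\<omega>. a p * \<omega> p) (normal_density 0 (\<bar>a p\<bar> * \<sigma>))"
      by (auto simp: L_def)
  qed
  also have "(\<lambda>\<omega>. \<Sum>p\<in>L. a p * \<omega> p) = (\<lambda>\<omega>. \<Sum>p\<in>K j. a p * \<omega> p)"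
    unfolding L_def using fK by (intro ext sum.mono_neutral_left) auto
  also have "sqrt (\<Sum>p\<in>L. (\<bar>a p\<bar> * \<sigma>)\<^sup>2) = \<sigma> * s"
    using \<sigma> s by (simp add: power_mult_distrib sum_distrib_right[symmetric] sL real_sqrt_mult)
  finally show "distributed (normal_PiM I \<sigma>) lborel (Y j) std_normal_density"
    using \<sigma> s by (subst (asm) normal_standard_normal_convert) (auto simp: Y_def)
qed

section \<open>Gaussian vectors and a net of the sphere\<close>

lemma vnorm_eq_L2_set: "vnorm d x = L2_set x {..<d}"
  by (simp add: vnorm_def dotp_def L2_set_def power2_eq_square)

lemma vnorm_nonneg [simp]: "0 \<le> vnorm d x"
  by (simp add: vnorm_eq_L2_set)

lemma vnorm_power2: "(vnorm d x)\<^sup>2 = dotp d x x"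
  by (simp add: vnorm_def dotp_def sum_nonneg)

lemma dotp_self: "dotp d x x = (\<Sum>k<d. (x k)\<^sup>2)"
  by (simp add: dotp_def power2_eq_square)

lemma dotp_self_nonneg [simp]: "0 \<le> dotp d x x"
  by (simp add: dotp_self sum_nonneg)

lemma abs_dotp_le: "\<bar>dotp d x y\<bar> \<le> vnorm d x * vnorm d y"
proof -
  have "\<bar>dotp d x y\<bar> \<le> (\<Sum>k<d. \<bar>x k\<bar> * \<bar>y k\<bar>)"
    unfolding dotp_def by (rule order_trans[OF sum_abs]) (simp add: abs_mult)
  also have "\<dots> \<le> vnorm d x * vnorm d y"
    unfolding vnorm_eq_L2_set by (rule L2_set_mult_ineq)
  finally show ?thesis .
qed

lemma vnorm_add_le: "vnorm d (\<lambda>k. x k + y k) \<le> vnorm d x + vnorm d y"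
  unfolding vnorm_eq_L2_set by (rule L2_set_triangle_ineq)

lemma vnorm_le_diff: "vnorm d x \<le> vnorm d y + vnorm d (\<lambda>k. x k - y k)"
  using vnorm_add_le[of d y "\<lambda>k. x k - y k"] by simp

lemma dotp_diff_right: "dotp d u (\<lambda>k. x k - y k) = dotp d u x - dotp d u y"
  by (simp add: dotp_def algebra_simps sum_subtractf)

lemma dotp_scale_right: "dotp d u (\<lambda>k. a * x k) = a * dotp d u x"
  by (simp add: dotp_def algebra_simps sum_distrib_left)

lemma vnorm_scale: "vnorm d (\<lambda>k. a * x k) = \<bar>a\<bar> * vnorm d x"
  by (simp add: vnorm_def dotp_self power_mult_distrib sum_distrib_left[symmetric] real_sqrt_mult)

text \<open>The net is the grid of points with coordinates z / d^3, |z| <= d^3. Rounding down costs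
  at most d^(-3) per coordinate, hence sqrt(d) / d^3 <= d^(-2) in norm, and the grid has (2 d^3 +
  1)^d <= d^(4 d) points because d >= 3.\<close>

lemma sphere_net:
  assumes d: "3 \<le> d"
  shows "\<exists>N. finite N \<and> card N \<le> d ^ (4 * d) \<and> (\<forall>y\<in>N. 0 < vnorm d y) \<and>
    (\<forall>x. vnorm d x = 1 \<longrightarrow> (\<exists>y\<in>N. vnorm d (\<lambda>k. x k - y k) \<le> 1 / real d ^ 2))"
proof -
  define Z where "Z = PiE {..<d} (\<lambda>_. {- int (d^3)..int (d^3)})"
  define h where "h = (\<lambda>(z::nat \<Rightarrow> int) k. real_of_int (z k) / real d ^ 3)"
  define N where "N = {y \<in> h ` Z. 0 < vnorm d y}"
  have fZ: "finite Z" unfolding Z_def by (intro finite_PiE) auto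
  have cZ: "card Z = (2 * d^3 + 1) ^ d"
    unfolding Z_def by (subst card_PiE) (auto simp: nat_add_distrib nat_mult_distrib nat_power_eq)
  have "2 * d^3 + 1 \<le> d ^ 4"
  proof -
    have "3 * d^3 \<le> d * d^3" using d by (intro mult_right_mono) auto
    moreover have "1 \<le> d^3" using d by simp
    moreover have "d * d^3 = d^4" by (simp add: eval_nat_numeral)
    ultimately show ?thesis by linarith
  qed
  then have "card Z \<le> (d ^ 4) ^ d" unfolding cZ by (intro power_mono) auto
  moreover have "card N \<le> card Z"
    using fZ card_mono[of "h ` Z" N] card_image_le[OF fZ, of h] by (auto simp: N_def)
  ultimately have cN: "card N \<le> d ^ (4 * d)" by (simp add: power_mult)
  have net: "\<exists>y\<in>N. vnorm d (\<lambda>k. x k - y k) \<le> 1 / real d ^ 2" if x: "vnorm d x = 1" for x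
  proof -
    define z where "z = (\<lambda>k\<in>{..<d}. \<lfloor>x k * real d ^ 3\<rfloor>)"
    have sumx: "(\<Sum>k<d. (x k)\<^sup>2) = 1" using vnorm_power2[of d x] x by (simp add: dotp_self)
    have xk: "\<bar>x k\<bar> \<le> 1" if "k < d" for k
    proof -
      have "(x k)\<^sup>2 \<le> (\<Sum>k<d. (x k)\<^sup>2)"
        using that by (intro member_le_sum) auto
      then show ?thesis using sumx by (simp add: abs_square_le_1)
    qed
    have zZ: "z \<in> Z"
      unfolding Z_def z_def
    proof (intro restrict_PiE_iff[THEN iffD2] ballI)
      fix k assume "k \<in> {..<d}"
      then have "\<bar>x k * real d ^ 3\<bar> \<le> 1 * real d ^ 3" unfolding abs_mult
        using xk by (intro mult_mono) auto
      then have a: "x k * real d ^ 3 \<le> real d ^ 3" "- (real d ^ 3) \<le> x k * real d ^ 3" by linarith+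
      then have "\<lfloor>x k * real d ^ 3\<rfloor> \<le> int (d ^ 3)" by (simp add: floor_le_iff)
      moreover have "- int (d ^ 3) \<le> \<lfloor>x k * real d ^ 3\<rfloor>" using a by (simp add: le_floor_iff)
      ultimately show "\<lfloor>x k * real d ^ 3\<rfloor> \<in> {- int (d^3)..int (d^3)}" by simp
    qed
    have diff: "\<bar>x k - h z k\<bar> \<le> 1 / real d ^ 3" if k: "k < d" for k
    proof -
      have "x k - h z k = (x k * real d ^ 3 - \<lfloor>x k * real d ^ 3\<rfloor>) / real d ^ 3"
        using d k by (simp add: h_def z_def field_simps)
      moreover have "\<bar>x k * real d ^ 3 - \<lfloor>x k * real d ^ 3\<rfloor>\<bar> \<le> 1" by linarith
      ultimately show ?thesis by (simp add: abs_divide divide_right_mono)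
    qed
    have "(\<Sum>k<d. (x k - h z k)\<^sup>2) \<le> (\<Sum>k<d. (1 / real d ^ 3)\<^sup>2)"
      using diff by (intro sum_mono) (metis abs_ge_zero lessThan_iff power2_abs power_mono)
    also have "\<dots> = real d / (real d ^ 3)\<^sup>2" by (simp add: power_divide)
    also have "\<dots> \<le> (1 / real d ^ 2)\<^sup>2"
    proof -
      have "real d * (real d)^4 \<le> (real d)^6"
        using d power_increasing[of 5 6 "real d"] by (simp add: eval_nat_numeral algebra_simps)
      then show ?thesis using d by (simp add: field_simps power_divide flip: power_mult)
    qed
    finally have le: "vnorm d (\<lambda>k. x k - h z k) \<le> 1 / real d ^ 2"
      unfolding vnorm_def dotp_self by (intro real_le_lsqrt sum_nonneg) auto
    also have "\<dots> < 1" using d by (simp add: power2_eq_square field_simps)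
       (metis less_1_mult numeral_less_iff of_nat_1 of_nat_less_iff le_less_trans numeral_One le_eq_less_or_eq less_trans one_less_numeral_iff semiring_norm(77))
    \<comment> \<open>A grid point at distance below 1 from a unit vector is nonzero, so it survives
      in \<open>N\<close>. Positive norm is what the tail bounds at net points require.\<close>
    finally have "0 < vnorm d (h z)" using vnorm_le_diff[of d x "h z"] x by linarith
    then have "h z \<in> N" using zZ by (auto simp: N_def)
    then show ?thesis using le by blast
  qed
  show ?thesis
    by (rule exI[of _ N]) (use cN net fZ in \<open>auto simp: N_def\<close>)
qed

section \<open>Tail bounds for Gaussian vectors\<close>

lemma gauss_vecs_eq: "gauss_vecs d n = normal_PiM ({..<n} \<times> {..<d}) (1 / sqrt (real d))"
  by (simp add: gauss_vecs_def normal_PiM_def)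

lemma prob_space_gauss_vecs: "0 < d \<Longrightarrow> prob_space (gauss_vecs d n)"
  unfolding gauss_vecs_eq by (intro prob_space_normal_PiM) simp

lemma measurable_gauss_vecs [measurable]:
  "i < n \<Longrightarrow> k < d \<Longrightarrow> (\<lambda>\<omega>. vecs_of \<omega> i k) \<in> borel_measurable (gauss_vecs d n)"
  unfolding gauss_vecs_eq vecs_of_def by (rule measurable_normal_PiM_component) simp

lemma gauss_vecs_rows:
  assumes d: "0 < d" and m: "m \<le> n" and x: "0 < vnorm d x"
  defines "Y \<equiv> \<lambda>j \<omega>. dotp d (vecs_of \<omega> j) x / (vnorm d x / sqrt d)"
  shows "prob_space.indep_vars (gauss_vecs d n) (\<lambda>_. borel) Y {..<m}"
    and "j < m \<Longrightarrow> distributed (gauss_vecs d n) lborel (Y j) std_normal_density"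
proof -
  have Y: "Y = (\<lambda>j \<omega>. (\<Sum>p\<in>{j} \<times> {..<d}. x (snd p) * \<omega> p) / (1 / sqrt (real d) * vnorm d x))"
    by (intro ext) (simp add: Y_def dotp_def vecs_of_def sum.cartesian_product' mult.commute)
  have *: "(\<Sum>p\<in>{j} \<times> {..<d}. (x (snd p))\<^sup>2) = (vnorm d x)\<^sup>2" for j
    by (simp add: vnorm_power2 dotp_self sum.cartesian_product')
  note L = normal_PiM_linear_forms[where I = "{..<n} \<times> {..<d}" and \<sigma> = "1 / sqrt (real d)" and J = "{..<m}" and K = "\<lambda>j. {j} \<times> {..<d}" and a = "\<lambda>p. x (snd p)", OF _ _ _ _ x *]
  show "prob_space.indep_vars (gauss_vecs d n) (\<lambda>_. borel) Y {..<m}"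
    unfolding gauss_vecs_eq Y using d m by (intro L) (auto simp: disjoint_family_on_def)
  show "j < m \<Longrightarrow> distributed (gauss_vecs d n) lborel (Y j) std_normal_density"
    unfolding gauss_vecs_eq Y using d m by (intro L) (auto simp: disjoint_family_on_def)
qed

text \<open>Here \<open>Y k\<close> is the normalized k-th coordinate of the combination of the
  random vectors with weights \<open>c\<close>. With \<open>c\<close> one fixed coordinate of all
  the vectors v_i, this combination is a column of the matrix \<Sum> u_i v_i^T.\<close>

lemma gauss_vecs_columns:
  fixes c :: "nat \<Rightarrow> real"
  assumes d: "0 < d" and c: "0 < (\<Sum>i<n. (c i)\<^sup>2)"
  defines "Y \<equiv> \<lambda>k \<omega>. (\<Sum>i<n. vecs_of \<omega> i k * c i) / (sqrt (\<Sum>i<n. (c i)\<^sup>2) / sqrt d)"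
  shows "prob_space.indep_vars (gauss_vecs d n) (\<lambda>_. borel) Y {..<d}"
    and "k < d \<Longrightarrow> distributed (gauss_vecs d n) lborel (Y k) std_normal_density"
proof -
  have Y: "Y = (\<lambda>k \<omega>. (\<Sum>p\<in>{..<n} \<times> {k}. c (fst p) * \<omega> p) / (1 / sqrt (real d) * sqrt (\<Sum>i<n. (c i)\<^sup>2)))"
    by (intro ext) (simp add: Y_def vecs_of_def sum.cartesian_product' mult.commute)
  have *: "(\<Sum>p\<in>{..<n} \<times> {k}. (c (fst p))\<^sup>2) = (sqrt (\<Sum>i<n. (c i)\<^sup>2))\<^sup>2" for k
    using c by (simp add: sum.cartesian_product')
  have c': "0 < sqrt (\<Sum>i<n. (c i)\<^sup>2)" using c by simp
  note L = normal_PiM_linear_forms[where I = "{..<n} \<times> {..<d}" and \<sigma> = "1 / sqrt (real d)" and J = "{..<d}" and K = "\<lambda>k. {..<n} \<times> {k}" and a = "\<lambda>p. c (fst p)", OF _ _ _ _ c' *]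
  show "prob_space.indep_vars (gauss_vecs d n) (\<lambda>_. borel) Y {..<d}"
    unfolding gauss_vecs_eq Y using d by (intro L) (auto simp: disjoint_family_on_def)
  show "k < d \<Longrightarrow> distributed (gauss_vecs d n) lborel (Y k) std_normal_density"
    unfolding gauss_vecs_eq Y using d by (intro L) (auto simp: disjoint_family_on_def)
qed

lemma gauss_vecs_entries:
  assumes d: "0 < d" and m: "m \<le> n"
  defines "Y \<equiv> \<lambda>p \<omega>. \<omega> p * sqrt d"
  shows "prob_space.indep_vars (gauss_vecs d n) (\<lambda>_. borel) Y ({..<m} \<times> {..<d})"
    and "p \<in> {..<m} \<times> {..<d} \<Longrightarrow> distributed (gauss_vecs d n) lborel (Y p) std_normal_density"
proof -
  have Y: "Y = (\<lambda>p \<omega>. (\<Sum>p\<in>{p}. 1 * \<omega> p) / (1 / sqrt (real d) * 1))"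
    by (intro ext) (simp add: Y_def)
  note L = normal_PiM_linear_forms[where I = "{..<n} \<times> {..<d}" and \<sigma> = "1 / sqrt (real d)" and J = "{..<m} \<times> {..<d}" and K = "\<lambda>p. {p}" and a = "\<lambda>p. 1" and s = 1]
  show "prob_space.indep_vars (gauss_vecs d n) (\<lambda>_. borel) Y ({..<m} \<times> {..<d})"
    unfolding gauss_vecs_eq Y using d m by (intro L) (auto simp: disjoint_family_on_def)
  show "p \<in> {..<m} \<times> {..<d} \<Longrightarrow> distributed (gauss_vecs d n) lborel (Y p) std_normal_density"
    unfolding gauss_vecs_eq Y using d m by (intro L) (auto simp: disjoint_family_on_def)
qed

lemma gauss_vecs_max_tail:
  assumes d: "0 < d" and m: "m \<le> n" and x: "0 < vnorm d x" and t: "0 \<le> t"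
  shows "measure (gauss_vecs d n) {\<omega> \<in> space (gauss_vecs d n). \<forall>j<m. dotp d (vecs_of \<omega> j) x \<le> t * vnorm d x / sqrt d}
    \<le> exp (- (exp (- (t + 1)\<^sup>2 / 2) / sqrt (2 * pi)) * m)"
proof -
  interpret prob_space "gauss_vecs d n" by (rule prob_space_gauss_vecs[OF d])
  note L = std_normal_max_tail[OF _ gauss_vecs_rows(1)[OF d m x] gauss_vecs_rows(2)[OF d m x] t]
  have "(dotp d (vecs_of \<omega> j) x \<le> t * vnorm d x / sqrt d) = (dotp d (vecs_of \<omega> j) x / (vnorm d x / sqrt d) \<le> t)" for \<omega> j
    using x d by (simp add: field_simps)
  then show ?thesis using L by (simp add: Ball_def)
qed

lemma gauss_vecs_abs_tail:
  assumes d: "0 < d" and x: "0 < vnorm d x" and \<delta>: "0 < \<delta>"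
  shows "measure (gauss_vecs d n) {\<omega> \<in> space (gauss_vecs d n).
      (\<Sum>j<n. \<bar>dotp d (vecs_of \<omega> j) x\<bar>) \<le> (1 - \<delta>) * sqrt (2 / pi) * n * (vnorm d x / sqrt d)}
    \<le> exp (- (\<delta>\<^sup>2 / pi) * n)"
proof -
  interpret prob_space "gauss_vecs d n" by (rule prob_space_gauss_vecs[OF d])
  note L = std_normal_sum_abs_tail[OF _ gauss_vecs_rows(1)[OF d order_refl x] gauss_vecs_rows(2)[OF d order_refl x] \<delta>]
  have s: "0 < vnorm d x / sqrt d" using x d by simp
  then have "((\<Sum>j<n. \<bar>dotp d (vecs_of \<omega> j) x\<bar>) \<le> (1 - \<delta>) * sqrt (2 / pi) * n * (vnorm d x / sqrt d))
     = ((\<Sum>j<n. \<bar>dotp d (vecs_of \<omega> j) x / (vnorm d x / sqrt d)\<bar>) \<le> (1 - \<delta>) * sqrt (2 / pi) * n)" for \<omega>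
    unfolding abs_divide sum_divide_distrib[symmetric] abs_of_pos[OF s]
    by (subst pos_divide_le_eq) auto
  then show ?thesis using L by simp
qed

lemma gauss_vecs_norm_tail:
  fixes \<delta> :: real
  assumes d: "0 < d" and m: "m \<le> n" and \<delta>: "0 < \<delta>"
  shows "measure (gauss_vecs d n) {\<omega> \<in> space (gauss_vecs d n).
      (1 + \<delta>) * m \<le> (\<Sum>j<m. dotp d (vecs_of \<omega> j) (vecs_of \<omega> j))}
    \<le> exp (- ((\<delta> - ln (1 + \<delta>)) / 2) * (m * d))"
proof -
  interpret prob_space "gauss_vecs d n" by (rule prob_space_gauss_vecs[OF d])
  note L = std_normal_sum_squares_tail[OF _ gauss_vecs_entries(1)[OF d m] gauss_vecs_entries(2)[OF d m] \<delta>]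
  have "(\<Sum>p\<in>{..<m}\<times>{..<d}. (\<omega> p * sqrt d)\<^sup>2) = real d * (\<Sum>j<m. dotp d (vecs_of \<omega> j) (vecs_of \<omega> j))" for \<omega>
    by (simp add: dotp_self vecs_of_def sum.cartesian_product power_mult_distrib sum_distrib_left mult.commute case_prod_beta)
  then have "((1 + \<delta>) * m \<le> (\<Sum>j<m. dotp d (vecs_of \<omega> j) (vecs_of \<omega> j)))
     = ((1 + \<delta>) * (m * d) \<le> (\<Sum>p\<in>{..<m}\<times>{..<d}. (\<omega> p * sqrt d)\<^sup>2))" for \<omega>
    using d by (simp add: mult.commute mult.left_commute)
  then show ?thesis using L by simp
qed

lemma gauss_vecs_column_tail:
  fixes \<delta> :: real and c :: "nat \<Rightarrow> real"
  assumes d: "0 < d" and c: "0 < (\<Sum>i<n. (c i)\<^sup>2)" and \<delta>: "0 < \<delta>"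
  shows "measure (gauss_vecs d n) {\<omega> \<in> space (gauss_vecs d n).
      (1 + \<delta>) * (\<Sum>i<n. (c i)\<^sup>2) \<le> (\<Sum>k<d. (\<Sum>i<n. vecs_of \<omega> i k * c i)\<^sup>2)}
    \<le> exp (- ((\<delta> - ln (1 + \<delta>)) / 2) * d)"
proof -
  interpret prob_space "gauss_vecs d n" by (rule prob_space_gauss_vecs[OF d])
  note L = std_normal_sum_squares_tail[OF _ gauss_vecs_columns(1)[OF d c] gauss_vecs_columns(2)[OF d c] \<delta>]
  define S where "S = (\<Sum>i<n. (c i)\<^sup>2)"
  have S: "S > 0" using c by (simp add: S_def)
  have "(\<Sum>k<d. ((\<Sum>i<n. vecs_of \<omega> i k * c i) / (sqrt S / sqrt d))\<^sup>2) = (d / S) * (\<Sum>k<d. (\<Sum>i<n. vecs_of \<omega> i k * c i)\<^sup>2)" for \<omega>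
    using d S by (simp add: power_divide sum_divide_distrib[symmetric] field_simps power_mult_distrib sum_distrib_left[symmetric])
  moreover have "((1 + \<delta>) * S \<le> T) = ((1 + \<delta>) * d \<le> (d / S) * T)" for T
    using d S mult_le_cancel_right[of "(1 + \<delta>) * S" "real d" T] by (simp add: field_simps)
  ultimately have "((1 + \<delta>) * S \<le> (\<Sum>k<d. (\<Sum>i<n. vecs_of \<omega> i k * c i)\<^sup>2))
     = ((1 + \<delta>) * d \<le> (\<Sum>k<d. ((\<Sum>i<n. vecs_of \<omega> i k * c i) / (sqrt S / sqrt d))\<^sup>2))" for \<omega>
    by presburger
  then show ?thesis using L unfolding S_def by simp
qed

section \<open>Separating matrices\<close>

text \<open>Separation consists of finitely many strict inequalities, hence is an open condition on
  W. The rational matrices floor(N W) / N converge to W, so one of them separates as well.\<close>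

lemma exists_sep_W_countable:
  "\<exists>Q :: (nat \<Rightarrow> nat \<Rightarrow> real) set. countable Q \<and>
    (\<forall>u v. exists_sep_W d n u v \<longleftrightarrow>
      (\<exists>W\<in>Q. \<forall>i<n. \<forall>j<n. j \<noteq> i \<longrightarrow> bilin d (u j) W (v i) < bilin d (u i) W (v i)))"
proof -
  define Z where "Z = PiE ({..<d} \<times> {..<d}) (\<lambda>_. UNIV :: int set)"
  define h where "h = (\<lambda>(N::nat, z :: nat \<times> nat \<Rightarrow> int) j k. real_of_int (z (j, k)) / real N)"
  define Q where "Q = h ` (UNIV \<times> Z)"
  have "countable Z" unfolding Z_def by (intro countable_PiE) auto
  then have cQ: "countable Q" unfolding Q_def by (intro countable_image countable_SIGMA) auto
  have "\<exists>W\<in>Q. \<forall>i<n. \<forall>j<n. j \<noteq> i \<longrightarrow> bilin d (u j) W (v i) < bilin d (u i) W (v i)"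
    if W: "\<forall>i<n. \<forall>j<n. j \<noteq> i \<longrightarrow> bilin d (u j) W (v i) < bilin d (u i) W (v i)" for u v W
  proof -
    define z where "z N = (\<lambda>p\<in>{..<d} \<times> {..<d}. \<lfloor>W (fst p) (snd p) * real N\<rfloor>)" for N
    define q where "q N = h (N, z N)" for N
    have qQ: "q N \<in> Q" for N unfolding Q_def q_def Z_def z_def by auto
    have lim: "(\<lambda>N. q N j k) \<longlonglongrightarrow> W j k" if "j < d" "k < d" for j k
    proof -
      have "(\<lambda>N. real_of_int \<lfloor>W j k * real N\<rfloor> / real N) \<longlonglongrightarrow> W j k"
        by real_asymp
      then show ?thesis using that by (simp add: q_def h_def z_def)
    qed
    have lim': "(\<lambda>N. bilin d x (q N) y) \<longlonglongrightarrow> bilin d x W y" for x y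
      unfolding bilin_def by (intro tendsto_sum tendsto_mult tendsto_const lim) auto
    have "\<forall>\<^sub>F N in sequentially. bilin d (u j) (q N) (v i) < bilin d (u i) (q N) (v i)"
      if "i < n" "j < n" "j \<noteq> i" for i j
    proof -
      have "(\<lambda>N. bilin d (u i) (q N) (v i) - bilin d (u j) (q N) (v i)) \<longlonglongrightarrow> bilin d (u i) W (v i) - bilin d (u j) W (v i)"
        by (intro tendsto_diff lim')
      moreover have "0 < bilin d (u i) W (v i) - bilin d (u j) W (v i)" using that W by simp
      ultimately have "\<forall>\<^sub>F N in sequentially. 0 < bilin d (u i) (q N) (v i) - bilin d (u j) (q N) (v i)"
        by (rule order_tendstoD)
      then show ?thesis by eventually_elim simp
    qed
    then have "\<forall>\<^sub>F N in sequentially. \<forall>i\<in>{..<n}. \<forall>j\<in>{..<n}. j \<noteq> i \<longrightarrow> bilin d (u j) (q N) (v i) < bilin d (u i) (q N) (v i)"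
      by (intro eventually_ball_finite ballI) (auto intro: eventually_mono)
    then obtain N where "\<forall>i\<in>{..<n}. \<forall>j\<in>{..<n}. j \<noteq> i \<longrightarrow> bilin d (u j) (q N) (v i) < bilin d (u i) (q N) (v i)"
      using eventually_happens'[OF sequentially_bot] by blast
    then show ?thesis using qQ[of N] by auto
  qed
  then show ?thesis using cQ unfolding exists_sep_W_def by (intro exI[of _ Q]) blast
qed

text \<open>Needed to pass to complements: \<open>measure\<close> defaults to 0 outside the
  sigma-algebra, so a small value alone would say nothing about the complementary event. The
  countable \<open>Q\<close> writes the event as a countable union.\<close>

lemma sets_exists_sep_W:
  assumes "\<And>i k. i < n \<Longrightarrow> k < d \<Longrightarrow> (\<lambda>\<omega>. U \<omega> i k) \<in> borel_measurable M"
    and "\<And>i k. i < n \<Longrightarrow> k < d \<Longrightarrow> (\<lambda>\<omega>. V \<omega> i k) \<in> borel_measurable M"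
  shows "{\<omega> \<in> space M. exists_sep_W d n (U \<omega>) (V \<omega>)} \<in> sets M"
proof -
  obtain Q where Q: "countable Q" "\<And>u v. exists_sep_W d n u v \<longleftrightarrow>
      (\<exists>W\<in>Q. \<forall>i<n. \<forall>j<n. j \<noteq> i \<longrightarrow> bilin d (u j) W (v i) < bilin d (u i) W (v i))"
    using exists_sep_W_countable[of d n] by blast
  have bm: "(\<lambda>\<omega>. bilin d (U \<omega> i) W (V \<omega> j)) \<in> borel_measurable M" if "i < n" "j < n" for i j W
    unfolding bilin_def using that by (intro borel_measurable_sum borel_measurable_times assms) auto
  have m: "{\<omega> \<in> space M. bilin d (U \<omega> j) W (V \<omega> i) < bilin d (U \<omega> i) W (V \<omega> i)} \<in> sets M"
    if "i < n" "j < n" for i j W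
    by (intro borel_measurable_less bm that)
  have "{\<omega> \<in> space M. \<forall>i\<in>{..<n}. \<forall>j\<in>{..<n}. j \<noteq> i \<longrightarrow> bilin d (U \<omega> j) W (V \<omega> i) < bilin d (U \<omega> i) W (V \<omega> i)} \<in> sets M" for W
    by (intro sets.sets_Collect_finite_All sets.sets_Collect_imp sets.sets_Collect_const m) simp_all
  then have "{\<omega> \<in> space M. \<exists>W\<in>Q. \<forall>i\<in>{..<n}. \<forall>j\<in>{..<n}. j \<noteq> i \<longrightarrow> bilin d (U \<omega> j) W (V \<omega> i) < bilin d (U \<omega> i) W (V \<omega> i)} \<in> sets M"
    by (intro sets.sets_Collect_countable_Ex' Q(1))
  then show ?thesis by (simp only: Q Ball_def lessThan_iff)
qed

section \<open>A deterministic obstruction to separation\<close>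

lemma bilin_eq_dotp: "bilin d u W v = dotp d u (\<lambda>r. dotp d (W r) v)"
  by (simp add: bilin_def dotp_def sum_distrib_left mult.assoc)

text \<open>With w_i = W v_i and F the Frobenius norm of W, separation would give \<theta> \<alpha>
  F <= \<theta> \<Sum> |w_i| <= \<Sum> <u_i, w_i> <= F B. Dividing by F contradicts
  \<open>less\<close>. No probability enters, and all bounds are uniform in x, so W may depend on
  the sample.\<close>

lemma not_exists_sep_W:
  assumes n: "2 \<le> n" and \<theta>: "0 \<le> \<theta>" and m: "m \<le> n"
    and mx: "\<And>x. \<exists>j<m. \<theta> * vnorm d x \<le> dotp d (u j) x"
    and B: "0 \<le> B" "(\<Sum>r<d. \<Sum>k<d. (\<Sum>i<n. u i r * v i k)\<^sup>2) \<le> B\<^sup>2"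
    and l1: "\<And>x. \<alpha> * vnorm d x \<le> (\<Sum>i<n. \<bar>dotp d (v i) x\<bar>)"
    and less: "B < \<theta> * \<alpha>"
  shows "\<not> exists_sep_W d n u v"
proof
  assume "exists_sep_W d n u v"
  then obtain W where W: "\<And>i j. i < n \<Longrightarrow> j < n \<Longrightarrow> j \<noteq> i \<Longrightarrow> bilin d (u j) W (v i) < bilin d (u i) W (v i)"
    by (auto simp: exists_sep_W_def)
  define w where "w i = (\<lambda>r. dotp d (W r) (v i))" for i
  define F where "F = L2_set (\<lambda>r. vnorm d (W r)) {..<d}"
  have F2: "F\<^sup>2 = (\<Sum>r<d. (vnorm d (W r))\<^sup>2)" by (simp add: F_def L2_set_def sum_nonneg)
  have F0: "F \<ge> 0" by (simp add: F_def)
  \<comment> \<open>If F = 0, all bilinear forms vanish and the strict inequality between the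
    indices 0 and 1 fails; this is where n >= 2 is used.\<close>
  have Fpos: "F \<noteq> 0"
  proof
    assume "F = 0"
    then have "vnorm d (W r) = 0" if "r < d" for r
      using that unfolding F_def by (subst (asm) L2_set_eq_0_iff) auto
    then have "w i r = 0" if "r < d" for i r
      using that abs_dotp_le[of d "W r" "v i"] by (simp add: w_def)
    then have "bilin d (u j) W (v i) = 0" for i j
      by (simp add: bilin_eq_dotp w_def[symmetric]) (simp add: dotp_def)
    then show False using W[of 0 1] n by simp
  qed
  \<comment> \<open>The index j realizing the lower bound is either i itself or is beaten by i
    through separation.\<close>
  have low: "\<theta> * vnorm d (w i) \<le> dotp d (u i) (w i)" if "i < n" for i
  proof -
    obtain j where j: "j < m" "\<theta> * vnorm d (w i) \<le> dotp d (u j) (w i)" using mx by blast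
    then show ?thesis using W[of i j] that m unfolding bilin_eq_dotp w_def[symmetric]
      by (cases "j = i") auto
  qed
  have cs: "(\<Sum>r<d. vnorm d (W r) * \<bar>dotp d (v i) (W r)\<bar>) \<le> F * vnorm d (w i)" for i
  proof -
    have "(\<Sum>r<d. vnorm d (W r) * \<bar>dotp d (v i) (W r)\<bar>) = (\<Sum>r<d. \<bar>vnorm d (W r)\<bar> * \<bar>w i r\<bar>)"
      by (simp add: w_def dotp_def mult.commute)
    also have "\<dots> \<le> F * vnorm d (w i)" unfolding F_def vnorm_eq_L2_set[of d "w i"] by (rule L2_set_mult_ineq)
    finally show ?thesis .
  qed
  \<comment> \<open>The bound \<open>l1\<close> is applied to each row of W, weighted by the norm of
    that row; \<open>cs\<close> then turns the weighted sums back into the norms of the w_i.\<close>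
  have "\<alpha> * F\<^sup>2 = (\<Sum>r<d. vnorm d (W r) * (\<alpha> * vnorm d (W r)))"
    unfolding F2 sum_distrib_left by (simp add: power2_eq_square algebra_simps)
  also have "\<dots> \<le> (\<Sum>r<d. vnorm d (W r) * (\<Sum>i<n. \<bar>dotp d (v i) (W r)\<bar>))"
    by (intro sum_mono mult_left_mono l1) auto
  also have "\<dots> = (\<Sum>i<n. \<Sum>r<d. vnorm d (W r) * \<bar>dotp d (v i) (W r)\<bar>)"
    by (subst sum.swap) (simp add: sum_distrib_left)
  also have "\<dots> \<le> F * (\<Sum>i<n. vnorm d (w i))"
    unfolding sum_distrib_left by (intro sum_mono cs)
  finally have "\<alpha> * F \<le> (\<Sum>i<n. vnorm d (w i))"
    using F0 Fpos by (simp add: power2_eq_square)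
  then have "\<theta> * (\<alpha> * F) \<le> \<theta> * (\<Sum>i<n. vnorm d (w i))"
    using \<theta> by (rule mult_left_mono)
  also have "\<dots> \<le> (\<Sum>i<n. dotp d (u i) (w i))"
    unfolding sum_distrib_left by (intro sum_mono low) auto
  \<comment> \<open>This is the Frobenius inner product of W with \<Sum> u_i v_i^T, to which
    Cauchy-Schwarz over the pairs (r, k) is applied next.\<close>
  also have "\<dots> = (\<Sum>r<d. \<Sum>k<d. W r k * (\<Sum>i<n. u i r * v i k))"
  proof -
    have "(\<Sum>i<n. dotp d (u i) (w i)) = (\<Sum>i<n. \<Sum>r<d. \<Sum>k<d. W r k * (u i r * v i k))"
      by (simp add: dotp_def w_def sum_distrib_left algebra_simps)
    also have "\<dots> = (\<Sum>r<d. \<Sum>k<d. \<Sum>i<n. W r k * (u i r * v i k))"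
      by (subst sum.swap, rule sum.cong[OF refl], rule sum.swap)
    finally show ?thesis by (simp add: sum_distrib_left)
  qed
  also have "\<dots> = (\<Sum>p\<in>{..<d}\<times>{..<d}. W (fst p) (snd p) * (\<Sum>i<n. u i (fst p) * v i (snd p)))"
    by (simp add: sum.cartesian_product')
  also have "\<dots> \<le> (\<Sum>p\<in>{..<d}\<times>{..<d}. \<bar>W (fst p) (snd p)\<bar> * \<bar>\<Sum>i<n. u i (fst p) * v i (snd p)\<bar>)"
    by (intro sum_mono) (simp add: abs_mult[symmetric])
  also have "\<dots> \<le> L2_set (\<lambda>p. W (fst p) (snd p)) ({..<d}\<times>{..<d}) * L2_set (\<lambda>p. \<Sum>i<n. u i (fst p) * v i (snd p)) ({..<d}\<times>{..<d})"
    by (rule L2_set_mult_ineq)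
  also have "L2_set (\<lambda>p. W (fst p) (snd p)) ({..<d}\<times>{..<d}) = F"
    by (simp add: L2_set_def F_def sum.cartesian_product' vnorm_power2 dotp_self)
  also have "F * L2_set (\<lambda>p. \<Sum>i<n. u i (fst p) * v i (snd p)) ({..<d}\<times>{..<d}) \<le> F * B"
    using B F0 by (intro mult_left_mono) (auto simp: L2_set_def sum.cartesian_product' intro!: real_le_lsqrt sum_nonneg)
  finally have "\<theta> * \<alpha> \<le> B" using F0 Fpos by (simp add: algebra_simps)
  then show False using less by simp
qed

text \<open>As m <= d^2, \<open>nrm\<close> forces |u_j| <= 2 d for every j < m, so replacing a unit
  vector by a net point at distance d^(-2) changes the inner product by at most 2 / d. That is
  negligible against sqrt(ln d / d); homogeneity then covers all x.\<close>

lemma net_max_imp_uniform_max: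
  fixes u :: "nat \<Rightarrow> nat \<Rightarrow> real"
  assumes d: "3 \<le> d" and m: "0 < m" "m \<le> d\<^sup>2" and t: "0 \<le> t"
    and net: "\<And>x. vnorm d x = 1 \<Longrightarrow> \<exists>y\<in>N. vnorm d (\<lambda>k. x k - y k) \<le> 1 / real d ^ 2"
    and mx: "\<And>y. y \<in> N \<Longrightarrow> \<exists>j<m. t * vnorm d y / sqrt d < dotp d (u j) y"
    and nrm: "(\<Sum>j<m. dotp d (u j) (u j)) \<le> 2 * real m"
  shows "\<exists>j<m. (t * (1 - 1 / real d ^ 2) / sqrt d - 2 / d) * vnorm d x \<le> dotp d (u j) x"
proof (cases "vnorm d x = 0")
  case True
  then have "dotp d (u 0) x = 0" using abs_dotp_le[of d "u 0" x] by simp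
  with True m show ?thesis by auto
next
  case False
  then have pos: "vnorm d x > 0" using vnorm_nonneg[of d x] by linarith
  define x' where "x' = (\<lambda>k. (1 / vnorm d x) * x k)"
  have x': "vnorm d x' = 1" unfolding x'_def vnorm_scale using pos by simp
  obtain y where y: "y \<in> N" "vnorm d (\<lambda>k. x' k - y k) \<le> 1 / real d ^ 2" using net[OF x'] by blast
  obtain j where j: "j < m" "t * vnorm d y / sqrt d < dotp d (u j) y" using mx[OF y(1)] by blast
  have "vnorm d (u j) \<le> 2 * d"
  proof -
    have "dotp d (u j) (u j) \<le> (\<Sum>j<m. dotp d (u j) (u j))" using j by (intro member_le_sum) auto
    also have "\<dots> \<le> 2 * real (d\<^sup>2)" using nrm m by (meson mult_left_mono of_nat_le_iff order_trans zero_le_numeral)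
    also have "\<dots> \<le> (2 * real d)\<^sup>2" by (simp add: power_mult_distrib)
    finally show ?thesis unfolding vnorm_def using real_le_lsqrt[of "2 * real d" "dotp d (u j) (u j)"] by simp
  qed
  have "\<bar>dotp d (u j) (\<lambda>k. x' k - y k)\<bar> \<le> vnorm d (u j) * vnorm d (\<lambda>k. x' k - y k)" by (rule abs_dotp_le)
  also have "\<dots> \<le> (2 * d) * (1 / real d ^ 2)" by (intro mult_mono y) (use \<open>vnorm d (u j) \<le> 2 * d\<close> in auto)
  also have "\<dots> = 2 / d" using d by (simp add: power2_eq_square)
  finally have 1: "dotp d (u j) y - 2 / d \<le> dotp d (u j) x'" unfolding dotp_diff_right by linarith
  have "1 - 1 / real d ^ 2 \<le> vnorm d y" using vnorm_le_diff[of d x' y] x' y by linarith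
  then have "t * (1 - 1 / real d ^ 2) / sqrt d \<le> t * vnorm d y / sqrt d"
    using t by (intro divide_right_mono mult_left_mono) auto
  with 1 j have "t * (1 - 1 / real d ^ 2) / sqrt d - 2 / d \<le> dotp d (u j) x'" by linarith
  also have "dotp d (u j) x' = dotp d (u j) x / vnorm d x" unfolding x'_def dotp_scale_right by simp
  finally show ?thesis using pos j by (auto simp: field_simps)
qed

section \<open>Failure probability for fixed v\<close>

lemma measurable_dotp_gauss_vecs:
  "i < n \<Longrightarrow> (\<lambda>\<omega>. dotp d (vecs_of \<omega> i) x) \<in> borel_measurable (gauss_vecs d n)"
  unfolding dotp_def
  by (intro borel_measurable_sum borel_measurable_times borel_measurable_const measurable_gauss_vecs) simp_all

lemma measurable_dotp_self_gauss_vecs: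
  "i < n \<Longrightarrow> (\<lambda>\<omega>. dotp d (vecs_of \<omega> i) (vecs_of \<omega> i)) \<in> borel_measurable (gauss_vecs d n)"
  unfolding dotp_def
  by (intro borel_measurable_sum borel_measurable_times borel_measurable_const measurable_gauss_vecs) simp_all

text \<open>Union bound over three failures: a small maximum at some net point (\<open>A\<close>),
  large norms among the first m vectors (\<open>E\<close>), a long column of \<Sum> u_i v_i^T
  (\<open>C\<close>). Only the first m vectors compete in the maximum, so their norms stay
  polynomial in d however large n is.\<close>

lemma prob_exists_sep_W_le:
  fixes v :: "nat \<Rightarrow> nat \<Rightarrow> real" and \<delta> S t \<beta> :: real
  assumes d: "3 \<le> d" and n: "2 \<le> n" and m: "0 < m" "m \<le> n" "m \<le> d\<^sup>2"
    and t: "0 \<le> t" and \<delta>: "0 < \<delta>"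
    and v2: "(\<Sum>i<n. dotp d (v i) (v i)) \<le> n * S"
    and l1: "\<And>x. n * \<beta> / sqrt d * vnorm d x \<le> (\<Sum>i<n. \<bar>dotp d (v i) x\<bar>)"
    and \<theta>: "0 \<le> \<theta>" "\<theta> = t * (1 - 1 / real d ^ 2) / sqrt d - 2 / d"
    and less: "sqrt ((1 + \<delta>) * (n * S)) < \<theta> * (n * \<beta> / sqrt d)"
  shows "measure (gauss_vecs d n) {\<omega> \<in> space (gauss_vecs d n). exists_sep_W d n (vecs_of \<omega>) v}
    \<le> real d ^ (4 * d) * exp (- (exp (- (t + 1)\<^sup>2 / 2) / sqrt (2 * pi)) * m)
      + exp (- ((1 - ln 2) / 2) * (real m * real d)) + d * exp (- ((\<delta> - ln (1 + \<delta>)) / 2) * d)"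
proof -
  let ?M = "gauss_vecs d n"
  have d0: "0 < d" using d by simp
  interpret prob_space ?M by (rule prob_space_gauss_vecs[OF d0])
  obtain N where N: "finite N" "card N \<le> d ^ (4 * d)" "\<And>y. y \<in> N \<Longrightarrow> 0 < vnorm d y"
    and net: "\<And>x. vnorm d x = 1 \<Longrightarrow> \<exists>y\<in>N. vnorm d (\<lambda>k. x k - y k) \<le> 1 / real d ^ 2"
    using sphere_net[OF d] by blast
  define c where "c k = (\<Sum>i<n. (v i k)\<^sup>2)" for k
  \<comment> \<open>The column tail needs positive variance. For the other k all
    \<open>v i k\<close> vanish, and the column is identically zero.\<close>
  define P where "P = {k. k < d \<and> 0 < c k}"
  define A where "A y = {\<omega> \<in> space ?M. \<forall>j<m. dotp d (vecs_of \<omega> j) y \<le> t * vnorm d y / sqrt d}" for y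
  \<comment> \<open>The factor 1 + 1 is the norm tail at \<delta> = 1, whence the rate (1 - ln 2) /
    2.\<close>
  define E where "E = {\<omega> \<in> space ?M. (1 + 1) * real m \<le> (\<Sum>j<m. dotp d (vecs_of \<omega> j) (vecs_of \<omega> j))}"
  \<comment> \<open>Distinct columns may be dependent, so each is controlled separately. The union
    bound costs a factor d, while the bounds (1 + \<delta>) c k still add up to (1 + \<delta>)
    \<Sum> |v_i|^2.\<close>
  define C where "C k = {\<omega> \<in> space ?M. (1 + \<delta>) * c k \<le> (\<Sum>r<d. (\<Sum>i<n. vecs_of \<omega> i r * v i k)\<^sup>2)}" for k
  have fP: "finite P" and cP: "card P \<le> d"
    using card_mono[of "{..<d}" P] by (auto simp: P_def)
  have Am: "A y \<in> events" for y
  proof -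
    have "{\<omega> \<in> space ?M. \<forall>j\<in>{..<m}. dotp d (vecs_of \<omega> j) y \<le> t * vnorm d y / sqrt d} \<in> events"
    proof (intro sets.sets_Collect_finite_All borel_measurable_le)
      fix j assume "j \<in> {..<m}"
      then show "(\<lambda>\<omega>. dotp d (vecs_of \<omega> j) y) \<in> borel_measurable ?M"
        using m by (intro measurable_dotp_gauss_vecs) simp
    qed simp_all
    then show ?thesis by (simp only: A_def Ball_def lessThan_iff)
  qed
  have "(\<lambda>\<omega>. \<Sum>j<m. dotp d (vecs_of \<omega> j) (vecs_of \<omega> j)) \<in> borel_measurable ?M"
    using m by (intro borel_measurable_sum measurable_dotp_self_gauss_vecs) simp
  then have Em: "E \<in> events" unfolding E_def by (intro borel_measurable_le borel_measurable_const)
  have "(\<lambda>\<omega>. \<Sum>r<d. (\<Sum>i<n. vecs_of \<omega> i r * v i k)\<^sup>2) \<in> borel_measurable ?M" for k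
    by (intro borel_measurable_sum borel_measurable_power borel_measurable_times borel_measurable_const measurable_gauss_vecs) simp_all
  then have Cm: "C k \<in> events" for k unfolding C_def by (intro borel_measurable_le borel_measurable_const)
  have UA: "(\<Union>y\<in>N. A y) \<in> events" and UC: "(\<Union>k\<in>P. C k) \<in> events"
    by (intro sets.finite_UN N(1) fP Am Cm)+
  have sub: "{\<omega> \<in> space ?M. exists_sep_W d n (vecs_of \<omega>) v} \<subseteq> (\<Union>y\<in>N. A y) \<union> E \<union> (\<Union>k\<in>P. C k)"
  proof (rule subsetI, rule ccontr)
    fix \<omega> assume \<omega>: "\<omega> \<in> {\<omega> \<in> space ?M. exists_sep_W d n (vecs_of \<omega>) v}"
      and no: "\<omega> \<notin> (\<Union>y\<in>N. A y) \<union> E \<union> (\<Union>k\<in>P. C k)"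
    have \<omega>s: "\<omega> \<in> space ?M" using \<omega> by blast
    have 1: "\<exists>j<m. t * vnorm d y / sqrt d < dotp d (vecs_of \<omega> j) y" if "y \<in> N" for y
    proof -
      have "\<omega> \<notin> A y" using that no by blast
      then show ?thesis using \<omega>s unfolding A_def by (auto simp: not_le)
    qed
    have 2: "(\<Sum>j<m. dotp d (vecs_of \<omega> j) (vecs_of \<omega> j)) \<le> 2 * real m"
    proof -
      have "\<omega> \<notin> E" using no by blast
      then show ?thesis using \<omega>s unfolding E_def by auto
    qed
    have 3: "(\<Sum>r<d. (\<Sum>i<n. vecs_of \<omega> i r * v i k)\<^sup>2) \<le> (1 + \<delta>) * c k" if k: "k < d" for k
    proof (cases "0 < c k")
      case True
      then have "k \<in> P" using k by (simp add: P_def)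
      then have "\<omega> \<notin> C k" using no by blast
      then show ?thesis using \<omega>s unfolding C_def by auto
    next
      case False
      then have "c k = 0" unfolding c_def using sum_nonneg[of "{..<n}" "\<lambda>i. (v i k)\<^sup>2"] by fastforce
      then have "v i k = 0" if "i < n" for i using that unfolding c_def by (subst (asm) sum_nonneg_eq_0_iff) auto
      then show ?thesis using \<open>c k = 0\<close> by simp
    qed
    have "(\<Sum>r<d. \<Sum>k<d. (\<Sum>i<n. vecs_of \<omega> i r * v i k)\<^sup>2) = (\<Sum>k<d. \<Sum>r<d. (\<Sum>i<n. vecs_of \<omega> i r * v i k)\<^sup>2)"
      by (rule sum.swap)
    also have "\<dots> \<le> (\<Sum>k<d. (1 + \<delta>) * c k)" by (intro sum_mono 3) auto
    also have "\<dots> = (1 + \<delta>) * (\<Sum>i<n. dotp d (v i) (v i))"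
      unfolding c_def dotp_self sum_distrib_left[symmetric]
      by (rule arg_cong[where f="(*) (1 + \<delta>)"], rule sum.swap)
    also have "\<dots> \<le> (1 + \<delta>) * (n * S)" using \<delta> v2 by (intro mult_left_mono) auto
    finally have 4: "(\<Sum>r<d. \<Sum>k<d. (\<Sum>i<n. vecs_of \<omega> i r * v i k)\<^sup>2) \<le> (1 + \<delta>) * (n * S)" .
    have 5: "0 \<le> (1 + \<delta>) * (n * S)" by (rule order_trans[OF _ 4]) (intro sum_nonneg, simp)
    have "\<not> exists_sep_W d n (vecs_of \<omega>) v"
    proof (rule not_exists_sep_W[OF n \<theta>(1) m(2), where B = "sqrt ((1 + \<delta>) * (n * S))" and \<alpha> = "n * \<beta> / sqrt d"])
      show "\<exists>j<m. \<theta> * vnorm d x \<le> dotp d (vecs_of \<omega> j) x" for x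
        unfolding \<theta>(2) by (rule net_max_imp_uniform_max[OF d m(1,3) t net 1 2])
      show "(\<Sum>r<d. \<Sum>k<d. (\<Sum>i<n. vecs_of \<omega> i r * v i k)\<^sup>2) \<le> (sqrt ((1 + \<delta>) * (n * S)))\<^sup>2"
        using 4 5 by simp
    qed (use 5 l1 less in auto)
    then show False using \<omega> by blast
  qed
  have "prob {\<omega> \<in> space ?M. exists_sep_W d n (vecs_of \<omega>) v} \<le> prob ((\<Union>y\<in>N. A y) \<union> E \<union> (\<Union>k\<in>P. C k))"
    by (intro finite_measure_mono[OF sub] sets.Un UA UC Em)
  also have "\<dots> \<le> prob ((\<Union>y\<in>N. A y) \<union> E) + prob (\<Union>k\<in>P. C k)"
    by (intro measure_Un_le sets.Un UA UC Em)
  also have "prob ((\<Union>y\<in>N. A y) \<union> E) + prob (\<Union>k\<in>P. C k) \<le> prob (\<Union>y\<in>N. A y) + prob E + prob (\<Union>k\<in>P. C k)"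
    by (intro add_right_mono measure_Un_le UA Em)
  finally have "prob {\<omega> \<in> space ?M. exists_sep_W d n (vecs_of \<omega>) v}
      \<le> prob (\<Union>y\<in>N. A y) + prob E + prob (\<Union>k\<in>P. C k)" .
  moreover have "prob (\<Union>y\<in>N. A y) \<le> real d ^ (4 * d) * exp (- (exp (- (t + 1)\<^sup>2 / 2) / sqrt (2 * pi)) * m)"
  proof -
    have "prob (\<Union>y\<in>N. A y) \<le> (\<Sum>y\<in>N. prob (A y))"
      by (intro measure_UNION_le N(1) Am)
    also have "\<dots> \<le> (\<Sum>y\<in>N. exp (- (exp (- (t + 1)\<^sup>2 / 2) / sqrt (2 * pi)) * m))"
      unfolding A_def by (intro sum_mono gauss_vecs_max_tail d0 m t N)
    also have "\<dots> = real (card N) * exp (- (exp (- (t + 1)\<^sup>2 / 2) / sqrt (2 * pi)) * m)" by simp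
    also have "\<dots> \<le> real d ^ (4 * d) * exp (- (exp (- (t + 1)\<^sup>2 / 2) / sqrt (2 * pi)) * m)"
      using N(2) by (intro mult_right_mono) (auto simp flip: of_nat_power)
    finally show ?thesis .
  qed
  moreover have "prob E \<le> exp (- ((1 - ln 2) / 2) * (real m * real d))"
    using gauss_vecs_norm_tail[OF d0 m(2), of 1] unfolding E_def by simp
  moreover have "prob (\<Union>k\<in>P. C k) \<le> d * exp (- ((\<delta> - ln (1 + \<delta>)) / 2) * d)"
  proof -
    have "prob (\<Union>k\<in>P. C k) \<le> (\<Sum>k\<in>P. prob (C k))"
      by (intro measure_UNION_le fP Cm)
    also have "\<dots> \<le> (\<Sum>k\<in>P. exp (- ((\<delta> - ln (1 + \<delta>)) / 2) * d))"
      unfolding C_def c_def by (intro sum_mono gauss_vecs_column_tail d0 \<delta>) (auto simp: P_def c_def)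
    also have "\<dots> \<le> d * exp (- ((\<delta> - ln (1 + \<delta>)) / 2) * d)"
      using cP by (simp add: mult_right_mono)
    finally show ?thesis .
  qed
  ultimately show ?thesis by linarith
qed

section \<open>The threshold\<close>

text \<open>The free parameter is r in t = sqrt(2 r ln d) - 1. Then exp(-(t + 1)^2 / 2) = d^(-r),
  and with m about \<gamma> d^2 / ln d the net term is d^(4 d) exp(- g d^(2 - r) / ln d), which is
  small when r < 1. The obstruction applies for large d when r > (1 + \<delta>) S / (2 \<beta>^2
  \<gamma>); \<open>less\<close> leaves room for both.\<close>

lemma prob_exists_sep_W_asymp:
  fixes \<gamma> \<beta> S :: real
  assumes \<gamma>: "0 < \<gamma>" and \<beta>: "0 < \<beta>" and S: "0 < S" and less: "S < 2 * \<beta>\<^sup>2 * \<gamma>"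
  shows "\<exists>c>0. \<exists>D. \<forall>d\<ge>D. \<forall>n. \<forall>v :: nat \<Rightarrow> nat \<Rightarrow> real.
    \<gamma> * real d ^ 2 / ln (real d) \<le> real n \<longrightarrow>
    (\<Sum>i<n. dotp d (v i) (v i)) \<le> n * S \<longrightarrow>
    (\<forall>x. n * \<beta> / sqrt d * vnorm d x \<le> (\<Sum>i<n. \<bar>dotp d (v i) x\<bar>)) \<longrightarrow>
    measure (gauss_vecs d n) {\<omega> \<in> space (gauss_vecs d n). exists_sep_W d n (vecs_of \<omega>) v} \<le> exp (- c * real d)"
proof -
  \<comment> \<open>\<rho> < 1 is exactly \<open>less\<close>; r is the midpoint of \<rho> and 1,
    and \<delta> is so small that (1 + \<delta>) \<rho> < r.\<close>
  define \<rho> where "\<rho> = S / (2 * \<beta>\<^sup>2 * \<gamma>)"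
  have \<rho>: "0 < \<rho>" "\<rho> < 1" using assms by (auto simp: \<rho>_def)
  define r where "r = (1 + \<rho>) / 2"
  have r: "0 < r" "\<rho> < r" "r < 1" using \<rho> by (auto simp: r_def)
  define \<delta> where "\<delta> = (r - \<rho>) / 2"
  have \<delta>: "0 < \<delta>" using r by (simp add: \<delta>_def)
  have "\<delta> * \<rho> < \<delta> * 1" using \<delta> \<rho> by (intro mult_strict_left_mono) auto
  moreover have "\<rho> + \<delta> < r" using r by (simp add: \<delta>_def field_simps)
  ultimately have \<delta>r: "(1 + \<delta>) * \<rho> < r" unfolding distrib_right by linarith
  define \<kappa> where "\<kappa> = (\<delta> - ln (1 + \<delta>)) / 2"
  have \<kappa>: "0 < \<kappa>" using ln_add_one_self_less_self[OF \<delta>] by (simp add: \<kappa>_def)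
  define \<kappa>' where "\<kappa>' = (1 - ln (2::real)) / 2"
  have "0 < (1 - l) / 2 \<and> (1 - l) / 2 \<le> 1" if "0 < l" "l < 1" for l :: real
    using that by auto
  from this[OF _ ln_2_less_1] have \<kappa>': "0 < \<kappa>'" "\<kappa>' \<le> 1"
    by (simp_all only: \<kappa>'_def ln_gt_zero_iff)
  define c where "c = min \<kappa> \<kappa>' / 2"
  have c: "0 < c" "2 * c \<le> \<kappa>" "2 * c \<le> \<kappa>'" using \<kappa> \<kappa>' by (auto simp: c_def)
  \<comment> \<open>After inserting n >= \<gamma> d^2 / ln d, the strict inequality required by
    \<open>prob_exists_sep_W_le\<close> follows from K < \<theta>^2 d / ln d, whose right side tends
    to 2 r.\<close>
  define K where "K = (1 + \<delta>) * S / (\<gamma> * \<beta>\<^sup>2)"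
  have K: "K < 2 * r"
  proof -
    have "K = 2 * ((1 + \<delta>) * \<rho>)" using \<gamma> \<beta> by (simp add: K_def \<rho>_def)
    then show ?thesis using \<delta>r by simp
  qed
  define g where "g = \<gamma> / sqrt (2 * pi)"
  have g: "0 < g" using \<gamma> by (simp add: g_def)
  define t where "t = (\<lambda>x::real. sqrt (2 * r * ln x) - 1)"
  define \<theta> where "\<theta> = (\<lambda>x::real. t x * (1 - 1 / x ^ 2) / sqrt x - 2 / x)"
  have "\<forall>\<^sub>F x::real in at_top. 0 \<le> t x" unfolding t_def using r by real_asymp
  moreover have "\<forall>\<^sub>F x::real in at_top. 0 \<le> \<theta> x" unfolding \<theta>_def t_def using r by real_asymp
  moreover have "\<forall>\<^sub>F x::real in at_top. K < (\<theta> x)\<^sup>2 * x / ln x"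
  proof -
    have "((\<lambda>x. (\<theta> x)\<^sup>2 * x / ln x) \<longlongrightarrow> 2 * r) at_top"
    proof -
      have "((2 * r) powr (1 / 2))\<^sup>2 = 2 * r" using r by (simp add: powr_half_sqrt)
      then show ?thesis unfolding \<theta>_def t_def using r by real_asymp
    qed
    then show ?thesis by (rule order_tendstoD(1)[OF _ K])
  qed
  moreover have "\<forall>\<^sub>F x::real in at_top. \<gamma> \<le> ln x" by real_asymp
  moreover have "\<forall>\<^sub>F x::real in at_top. 1 < \<gamma> * x ^ 2 / ln x" using \<gamma> by real_asymp
  moreover have "\<forall>\<^sub>F x::real in at_top. 4 * x * ln x - g * (x powr (2 - r) / ln x) \<le> - x"
  proof -
    \<comment> \<open>Splitting off one factor x isolates x powr (1 - r), the positive power that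
      beats the square of the logarithm.\<close>
    have "0 < 1 - r" using r by simp
    then have "\<forall>\<^sub>F x::real in at_top. 4 * x * ln x - g * (x * (x powr (1 - r)) / ln x) \<le> - x"
      using g by real_asymp
    then show ?thesis
      using eventually_gt_at_top[of 0]
    proof eventually_elim
      case (elim x)
      have "x * (x powr (1 - r)) = x powr 1 * x powr (1 - r)" using elim by simp
      also have "\<dots> = x powr (2 - r)" unfolding powr_add[symmetric] by simp
      finally show ?case using elim by simp
    qed
  qed
  moreover have "\<forall>\<^sub>F x::real in at_top. x + 2 \<le> exp (c * x)" using c by real_asymp
  moreover have "\<forall>\<^sub>F x::real in at_top. 3 \<le> x" by (rule eventually_ge_at_top)
  ultimately have "\<forall>\<^sub>F x::real in at_top. 0 \<le> t x \<and> 0 \<le> \<theta> x \<and> K < (\<theta> x)\<^sup>2 * x / ln x \<and> \<gamma> \<le> ln x \<and>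
     1 < \<gamma> * x ^ 2 / ln x \<and> 4 * x * ln x - g * (x powr (2 - r) / ln x) \<le> - x \<and> x + 2 \<le> exp (c * x) \<and> 3 \<le> x"
    by eventually_elim blast
  then have "\<forall>\<^sub>F d in sequentially. 0 \<le> t (real d) \<and> 0 \<le> \<theta> (real d) \<and> K < (\<theta> (real d))\<^sup>2 * real d / ln (real d) \<and> \<gamma> \<le> ln (real d) \<and>
     1 < \<gamma> * real d ^ 2 / ln (real d) \<and> 4 * real d * ln (real d) - g * (real d powr (2 - r) / ln (real d)) \<le> - real d \<and> real d + 2 \<le> exp (c * real d) \<and> 3 \<le> real d"
    by (rule eventually_compose_filterlim) (rule filterlim_real_sequentially)
  then obtain D where D: "\<And>d. D \<le> d \<Longrightarrow> 0 \<le> t (real d) \<and> 0 \<le> \<theta> (real d) \<and> K < (\<theta> (real d))\<^sup>2 * real d / ln (real d) \<and> \<gamma> \<le> ln (real d) \<and>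
     1 < \<gamma> * real d ^ 2 / ln (real d) \<and> 4 * real d * ln (real d) - g * (real d powr (2 - r) / ln (real d)) \<le> - real d \<and> real d + 2 \<le> exp (c * real d) \<and> 3 \<le> real d"
    unfolding eventually_sequentially by blast
  show ?thesis
  proof (intro exI conjI allI impI)
    show "0 < c" by (rule c)
    fix d n :: nat and v :: "nat \<Rightarrow> nat \<Rightarrow> real"
    assume dD: "D \<le> d" and n: "\<gamma> * real d ^ 2 / ln (real d) \<le> real n"
      and v2: "(\<Sum>i<n. dotp d (v i) (v i)) \<le> n * S"
      and l1: "\<forall>x. n * \<beta> / sqrt d * vnorm d x \<le> (\<Sum>i<n. \<bar>dotp d (v i) x\<bar>)"
    define x where "x = real d"
    have t0: "0 \<le> t x" and \<theta>0: "0 \<le> \<theta> x" and K': "K < (\<theta> x)\<^sup>2 * x / ln x" and ln\<gamma>: "\<gamma> \<le> ln x"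
      and n1: "1 < \<gamma> * x ^ 2 / ln x" and e1: "4 * x * ln x - g * (x powr (2 - r) / ln x) \<le> - x"
      and e2: "x + 2 \<le> exp (c * x)" and x3: "3 \<le> x"
      using D[OF dD] unfolding x_def by blast+
    have d3: "3 \<le> d" using x3 by (simp add: x_def)
    have lnx: "0 < ln x" using ln\<gamma> \<gamma> by linarith
    \<comment> \<open>The least integer at the threshold: it is at most n by hypothesis, and at most
      d^2 because \<gamma> <= ln d.\<close>
    define m where "m = nat \<lceil>\<gamma> * x ^ 2 / ln x\<rceil>"
    have m_ge: "\<gamma> * x ^ 2 / ln x \<le> real m" unfolding m_def by linarith
    have m0: "0 < m" using m_ge n1 by (cases m) auto
    have mn: "m \<le> n" using n unfolding m_def x_def by (simp add: nat_le_iff ceiling_le_iff)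
    have md: "m \<le> d\<^sup>2"
    proof -
      have "\<gamma> * x ^ 2 / ln x \<le> x ^ 2" using ln\<gamma> lnx by (simp add: divide_le_eq mult.commute mult_right_mono)
      then show ?thesis unfolding m_def x_def by (simp add: nat_le_iff ceiling_le_iff)
    qed
    have n2: "2 \<le> n" using n n1 unfolding x_def by linarith
    have sq: "sqrt ((1 + \<delta>) * (n * S)) < \<theta> x * (n * \<beta> / sqrt d)"
    proof (rule real_less_lsqrt)
      show "0 \<le> \<theta> x * (n * \<beta> / sqrt d)" using \<theta>0 \<beta> by simp
      have n0: "0 < real n" using n2 by simp
      have "(1 + \<delta>) * S * x < (\<theta> x)\<^sup>2 * \<beta>\<^sup>2 * (\<gamma> * x\<^sup>2 / ln x)"
      proof -
        have "K * (\<gamma> * \<beta>\<^sup>2 * x) < ((\<theta> x)\<^sup>2 * x / ln x) * (\<gamma> * \<beta>\<^sup>2 * x)"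
          using K' \<gamma> \<beta> x3 by (intro mult_strict_right_mono) auto
        moreover have "K * (\<gamma> * \<beta>\<^sup>2 * x) = (1 + \<delta>) * S * x" using \<gamma> \<beta> by (simp add: K_def)
        ultimately show ?thesis by (simp add: power2_eq_square algebra_simps)
      qed
      also have "\<dots> \<le> (\<theta> x)\<^sup>2 * \<beta>\<^sup>2 * n" using n unfolding x_def by (intro mult_left_mono) auto
      finally have "(1 + \<delta>) * S * x * (n / x) < (\<theta> x)\<^sup>2 * \<beta>\<^sup>2 * n * (n / x)"
        using n0 x3 by (intro mult_strict_right_mono) auto
      then show "(1 + \<delta>) * (n * S) < (\<theta> x * (n * \<beta> / sqrt d))\<^sup>2"
        using x3 by (simp add: power_mult_distrib power_divide x_def power2_eq_square[of "real n"] algebra_simps)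
    qed
    have "measure (gauss_vecs d n) {\<omega> \<in> space (gauss_vecs d n). exists_sep_W d n (vecs_of \<omega>) v}
      \<le> real d ^ (4 * d) * exp (- (exp (- (t x + 1)\<^sup>2 / 2) / sqrt (2 * pi)) * m)
      + exp (- ((1 - ln 2) / 2) * (real m * real d)) + d * exp (- ((\<delta> - ln (1 + \<delta>)) / 2) * d)"
      by (rule prob_exists_sep_W_le[OF d3 n2 m0 mn md t0 \<delta> v2 l1[rule_format] \<theta>0 _ sq]) (simp add: \<theta>_def x_def)
    \<comment> \<open>Each error term is brought to rate 2 c, so that the common prefactor x + 2 can
      be absorbed by exp(c x), leaving rate c.\<close>
    also have "\<dots> \<le> exp (- 2 * c * x) + exp (- 2 * c * x) + x * exp (- 2 * c * x)"
    proof (intro add_mono)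
      have "(t x + 1)\<^sup>2 / 2 = r * ln x" using r lnx by (simp add: t_def)
      then have "exp (- (t x + 1)\<^sup>2 / 2) = exp (- (r * ln x))" by (metis minus_divide_left)
      also have "\<dots> = x powr (- r)" using x3 by (simp add: powr_def)
      finally have q: "exp (- (t x + 1)\<^sup>2 / 2) = x powr (- r)" .
      have "x powr (- r) * x ^ 2 = x powr (2 - r)"
        using x3 powr_realpow[of x 2] powr_add[of x "-r" 2] by simp
      then have "g * (x powr (2 - r) / ln x) = (x powr (- r) / sqrt (2 * pi)) * (\<gamma> * x ^ 2 / ln x)"
        by (simp add: g_def)
      also have "\<dots> \<le> (x powr (- r) / sqrt (2 * pi)) * m"
        using m_ge by (intro mult_left_mono) auto
      finally have "4 * x * ln x - (x powr (- r) / sqrt (2 * pi)) * m \<le> - x" using e1 by linarith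
      also have "- x \<le> - (2 * c) * x" using c \<kappa>' x3 mult_right_mono[of "2 * c" 1 x] by linarith
      finally have le: "4 * x * ln x - (x powr (- r) / sqrt (2 * pi)) * m \<le> - 2 * c * x" by simp
      have "real d ^ (4 * d) = exp (4 * x * ln x)"
      proof -
        have "real d ^ (4 * d) = x powr (real (4 * d))" unfolding x_def using d3 by (subst powr_realpow) auto
        also have "\<dots> = exp (4 * x * ln x)" using x3 by (simp add: powr_def x_def)
        finally show ?thesis .
      qed
      then have "real d ^ (4 * d) * exp (- (exp (- (t x + 1)\<^sup>2 / 2) / sqrt (2 * pi)) * m)
         = exp (4 * x * ln x - (x powr (- r) / sqrt (2 * pi)) * m)"
        unfolding q by (simp add: exp_diff exp_minus divide_inverse)
      also have "\<dots> \<le> exp (- 2 * c * x)" using le by simp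
      finally show "real d ^ (4 * d) * exp (- (exp (- (t x + 1)\<^sup>2 / 2) / sqrt (2 * pi)) * m) \<le> exp (- 2 * c * x)" .
      have "2 * c * x \<le> \<kappa>' * (m * x)"
      proof (rule mult_mono[of "2 * c" \<kappa>' x "m * x", THEN order_trans])
        show "x \<le> m * x" using m0 x3 by (simp add: x_def)
      qed (use c \<kappa>' x3 in auto)
      then show "exp (- ((1 - ln 2) / 2) * (real m * real d)) \<le> exp (- 2 * c * x)"
        unfolding \<kappa>'_def[symmetric] x_def by simp
      have "2 * c * x \<le> \<kappa> * x" using c x3 by (intro mult_right_mono) auto
      then show "d * exp (- ((\<delta> - ln (1 + \<delta>)) / 2) * d) \<le> x * exp (- 2 * c * x)"
        unfolding \<kappa>_def[symmetric] x_def by (intro mult_left_mono) auto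
    qed
    also have "\<dots> = (x + 2) * (exp (- c * x) * exp (- c * x))"
      by (simp add: exp_add[symmetric] algebra_simps)
    also have "\<dots> \<le> exp (c * x) * (exp (- c * x) * exp (- c * x))"
      using e2 by (intro mult_right_mono) auto
    also have "\<dots> = exp (- c * real d)" by (simp add: x_def exp_add[symmetric])
    finally show "measure (gauss_vecs d n) {\<omega> \<in> space (gauss_vecs d n). exists_sep_W d n (vecs_of \<omega>) v} \<le> exp (- c * real d)" .
  qed
qed

section \<open>Lower bounds on absolute first moments\<close>

lemma sum_abs_dotp_ge_of_unit:
  assumes unit: "\<And>x. vnorm d x = 1 \<Longrightarrow> \<alpha> \<le> (\<Sum>i<n. \<bar>dotp d (v i) x\<bar>)"
  shows "\<alpha> * vnorm d x \<le> (\<Sum>i<n. \<bar>dotp d (v i) x\<bar>)"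
proof (cases "vnorm d x = 0")
  case True
  then show ?thesis by (simp add: sum_nonneg)
next
  case False
  then have pos: "vnorm d x > 0" using vnorm_nonneg[of d x] by linarith
  have "vnorm d (\<lambda>k. (1 / vnorm d x) * x k) = 1" unfolding vnorm_scale using pos by simp
  then have "\<alpha> \<le> (\<Sum>i<n. \<bar>dotp d (v i) (\<lambda>k. (1 / vnorm d x) * x k)\<bar>)" by (rule unit)
  also have "\<dots> = (\<Sum>i<n. \<bar>dotp d (v i) x\<bar>) / vnorm d x"
    unfolding dotp_scale_right abs_mult using pos by (simp add: sum_divide_distrib)
  finally show ?thesis using pos by (simp add: field_simps)
qed

text \<open>A first moment is bounded below by the second and fourth, as in the Hoelder estimate
  E|a| >= (E a^2)^(3/2) / (E a^4)^(1/2). With E a^2 >= c0 / d and E a^4 <= K / d^2 this is c0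
  sqrt(c0 / K) / sqrt(d), the value of \<beta> / sqrt(d) for a fixed design.\<close>

lemma sum_abs_dotp_ge_of_moments:
  fixes v :: "nat \<Rightarrow> nat \<Rightarrow> real"
  assumes n: "0 < n" and d: "0 < d" and c0: "0 < c0" and K: "0 < K"
    and m2: "\<And>x. (1 / real n) * (\<Sum>i<n. (dotp d (v i) x) ^ 2) \<ge> (c0 / real d) * dotp d x x"
    and m4: "tensor4_norm d n v \<le> K / real d ^ 2"
  shows "n * (c0 * sqrt (c0 / K)) / sqrt d * vnorm d x \<le> (\<Sum>i<n. \<bar>dotp d (v i) x\<bar>)"
proof -
  have unit: "n * (c0 * sqrt (c0 / K)) / sqrt d \<le> (\<Sum>i<n. \<bar>dotp d (v i) x\<bar>)" if x: "vnorm d x = 1" for x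
  proof -
    \<comment> \<open>The supremum in \<open>tensor4_norm\<close> dominates its members only once
      the set is known to be bounded; Cauchy-Schwarz provides this.\<close>
    have bdd: "bdd_above ((\<lambda>x. (1 / real n) * (\<Sum>i<n. (dotp d (v i) x) ^ 4)) ` {x. vnorm d x = 1})"
    proof (rule bdd_aboveI2)
      fix x assume "x \<in> {x. vnorm d x = 1}"
      then have "\<bar>dotp d (v i) x\<bar> \<le> vnorm d (v i)" for i using abs_dotp_le[of d "v i" x] by simp
      then have "\<bar>dotp d (v i) x\<bar> ^ 4 \<le> vnorm d (v i) ^ 4" for i by (intro power_mono) auto
      then show "(1 / real n) * (\<Sum>i<n. (dotp d (v i) x) ^ 4) \<le> (1 / real n) * (\<Sum>i<n. vnorm d (v i) ^ 4)"
        by (intro mult_left_mono sum_mono) auto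
    qed
    have "(1 / real n) * (\<Sum>i<n. (dotp d (v i) x) ^ 4) \<le> tensor4_norm d n v"
      unfolding tensor4_norm_def by (rule cSUP_upper[OF _ bdd]) (simp add: x)
    then have "(1 / real n) * (\<Sum>i<n. (dotp d (v i) x) ^ 4) \<le> K / real d ^ 2" using m4 by linarith
    then have s4: "(\<Sum>i<n. (dotp d (v i) x) ^ 4) \<le> n * (K / real d ^ 2)" using n by (simp add: field_simps)
    have "dotp d x x = 1" using vnorm_power2[of d x] x by simp
    then have s2: "n * (c0 / real d) \<le> (\<Sum>i<n. (dotp d (v i) x)\<^sup>2)" using m2[of x] n by (simp add: field_simps)
    \<comment> \<open>\<tau>^2 is the ratio of the fourth moment bound K / d^2 to the second moment
      bound c0 / d, which optimizes the estimate below.\<close>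
    define \<tau> where "\<tau> = sqrt (K / (c0 * d))"
    have \<tau>: "0 < \<tau>" "\<tau>\<^sup>2 = K / (c0 * d)" using K c0 d by (auto simp: \<tau>_def)
    \<comment> \<open>Tangent bound at \<open>\<bar>a\<bar> = \<tau>\<close>: it trades the first moment for the second and the fourth.\<close>
    have tangent: "3 / (2 * \<tau>) * a\<^sup>2 - 1 / (2 * \<tau> ^ 3) * a ^ 4 \<le> \<bar>a\<bar>" for a :: real
    proof -
      define y where "y = \<bar>a\<bar> / \<tau>"
      have y: "0 \<le> y" "\<bar>a\<bar> = \<tau> * y" using \<tau> by (auto simp: y_def)
      \<comment> \<open>The product expands to y^4 - 3 y^2 + 2 y; the double root at y = 1 is the
        tangency.\<close>
      have "0 \<le> y * ((y - 1)\<^sup>2 * (y + 2))" using y by simp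
      then have "3 * y\<^sup>2 - y ^ 4 \<le> 2 * y" by (simp add: power2_eq_square eval_nat_numeral algebra_simps)
      then have "\<tau> * (3 * y\<^sup>2 - y ^ 4) \<le> \<tau> * (2 * y)" using \<tau> by (intro mult_left_mono) auto
      moreover have "a\<^sup>2 = \<tau>\<^sup>2 * y\<^sup>2" using y(2) by (metis power2_abs power_mult_distrib)
      moreover have "a ^ 4 = \<tau> ^ 4 * y ^ 4" using y(2) by (metis power_even_abs_numeral power_mult_distrib even_numeral)
      moreover have "3 / (2 * \<tau>) * (\<tau>\<^sup>2 * y\<^sup>2) - 1 / (2 * \<tau> ^ 3) * (\<tau> ^ 4 * y ^ 4) = \<tau> * (3 * y\<^sup>2 - y ^ 4) / 2"
        using \<tau>(1) by (simp add: field_simps eval_nat_numeral)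
      ultimately show ?thesis using y(2) by simp
    qed
    have "n * (c0 * sqrt (c0 / K)) / sqrt d = 3 / (2 * \<tau>) * (n * (c0 / real d)) - 1 / (2 * \<tau> ^ 3) * (n * (K / real d ^ 2))"
    proof -
      have "1 / (2 * \<tau> ^ 3) * (n * (K / real d ^ 2)) = 1 / (2 * \<tau>) * (n * (c0 / real d))"
      proof -
        have "\<tau> ^ 3 = \<tau> * (K / (c0 * d))" using \<tau>(2) by (simp add: power3_eq_cube power2_eq_square)
        then show ?thesis using \<tau>(1) K c0 d by (simp add: power2_eq_square field_simps)
      qed
      then have "3 / (2 * \<tau>) * (n * (c0 / real d)) - 1 / (2 * \<tau> ^ 3) * (n * (K / real d ^ 2)) = n * (c0 / d) / \<tau>"
        using \<tau>(1) by (simp add: field_simps)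
      also have "\<dots> = n * (c0 * sqrt (c0 / K)) / sqrt d"
        unfolding \<tau>_def using K c0 d by (simp add: real_sqrt_divide real_sqrt_mult field_simps)
      finally show ?thesis by simp
    qed
    also have "\<dots> \<le> 3 / (2 * \<tau>) * (\<Sum>i<n. (dotp d (v i) x)\<^sup>2) - 1 / (2 * \<tau> ^ 3) * (\<Sum>i<n. (dotp d (v i) x) ^ 4)"
      using s2 s4 \<tau> by (intro diff_mono mult_left_mono) auto
    also have "\<dots> = (\<Sum>i<n. 3 / (2 * \<tau>) * (dotp d (v i) x)\<^sup>2 - 1 / (2 * \<tau> ^ 3) * (dotp d (v i) x) ^ 4)"
      by (simp add: sum_subtractf sum_distrib_left)
    also have "\<dots> \<le> (\<Sum>i<n. \<bar>dotp d (v i) x\<bar>)" by (intro sum_mono tangent)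
    finally show ?thesis .
  qed
  show ?thesis by (rule sum_abs_dotp_ge_of_unit[OF unit])
qed

section \<open>Fixed and Gaussian designs\<close>

lemma (in prob_space) prob_not_ge:
  assumes "{\<omega> \<in> space M. Q \<omega>} \<in> events" "prob {\<omega> \<in> space M. Q \<omega>} \<le> e"
  shows "1 - e \<le> prob {\<omega> \<in> space M. \<not> Q \<omega>}"
  using prob_neg[OF assms(1)] assms(2) by linarith

lemma threshold_pos:
  fixes \<gamma> :: real
  assumes "0 < \<gamma>" "2 \<le> d" "\<gamma> * real d ^ 2 / ln (real d) \<le> real n"
  shows "0 < n"
proof -
  have "0 < ln (real d)" using assms by simp
  then have "0 < \<gamma> * real d ^ 2 / ln (real d)" using assms by simp
  then show ?thesis using assms by linarith
qed

lemma no_separating_matrix_fixed_design: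
  fixes K1 K2 c0 :: real
  assumes c0: "0 < c0"
  shows "\<exists>C. \<exists>c>0. \<exists>D::nat. \<forall>d\<ge>D. \<forall>n::nat. \<forall>v :: nat \<Rightarrow> nat \<Rightarrow> real.
            real n \<ge> C * real d ^ 2 / ln (real d) \<longrightarrow>
            (\<forall>i<n. vnorm d (v i) \<le> K1) \<longrightarrow>
            (\<forall>x. (1 / real n) * (\<Sum>i<n. (dotp d (v i) x) ^ 2) \<ge> (c0 / real d) * dotp d x x) \<longrightarrow>
            tensor4_norm d n v \<le> K2 / real d ^ 2 \<longrightarrow>
            measure (gauss_vecs d n)
              {\<omega> \<in> space (gauss_vecs d n). \<not> exists_sep_W d n (vecs_of \<omega>) v}
            \<ge> 1 - exp (- c * real d)"
proof -
  \<comment> \<open>The given constants may have any sign, so K2 is enlarged to a positive K and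
    K1^2 to a positive S. The choice \<gamma> = S / \<beta>^2 makes 2 \<beta>^2 \<gamma> = 2 S > S,
    and \<gamma> serves as the constant C.\<close>
  define K where "K = max K2 1"
  have K: "0 < K" "K2 \<le> K" by (auto simp: K_def)
  define \<beta> where "\<beta> = c0 * sqrt (c0 / K)"
  have \<beta>: "0 < \<beta>" using c0 K by (simp add: \<beta>_def)
  define S where "S = K1\<^sup>2 + 1"
  have S: "0 < S" "K1\<^sup>2 \<le> S" by (auto simp: S_def add_nonneg_pos)
  define \<gamma> where "\<gamma> = S / \<beta>\<^sup>2"
  have \<gamma>: "0 < \<gamma>" using S \<beta> by (simp add: \<gamma>_def)
  have "S < 2 * \<beta>\<^sup>2 * \<gamma>" using S \<beta> by (simp add: \<gamma>_def)
  from prob_exists_sep_W_asymp[OF \<gamma> \<beta> S(1) this] obtain c D where c: "0 < c"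
    and D: "\<And>d n v. D \<le> d \<Longrightarrow> \<gamma> * real d ^ 2 / ln (real d) \<le> real n \<Longrightarrow>
      (\<Sum>i<n. dotp d (v i) (v i)) \<le> n * S \<Longrightarrow>
      (\<forall>x. n * \<beta> / sqrt d * vnorm d x \<le> (\<Sum>i<n. \<bar>dotp d (v i) x\<bar>)) \<Longrightarrow>
      measure (gauss_vecs d n) {\<omega> \<in> space (gauss_vecs d n). exists_sep_W d n (vecs_of \<omega>) v} \<le> exp (- c * real d)"
    by blast
  show ?thesis
  proof (rule exI[of _ \<gamma>], rule exI[of _ c], rule conjI[OF c], rule exI[of _ "max D 2"], intro allI impI)
    fix d n :: nat and v :: "nat \<Rightarrow> nat \<Rightarrow> real"
    assume d: "max D 2 \<le> d" and n: "\<gamma> * real d ^ 2 / ln (real d) \<le> real n"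
      and v1: "\<forall>i<n. vnorm d (v i) \<le> K1"
      and m2: "\<forall>x. (c0 / real d) * dotp d x x \<le> (1 / real n) * (\<Sum>i<n. (dotp d (v i) x) ^ 2)"
      and m4: "tensor4_norm d n v \<le> K2 / real d ^ 2"
    have d0: "0 < d" and n0: "0 < n" using d threshold_pos[OF \<gamma> _ n] by auto
    interpret prob_space "gauss_vecs d n" by (rule prob_space_gauss_vecs[OF d0])
    have m4': "tensor4_norm d n v \<le> K / real d ^ 2"
      using m4 K(2) by (meson divide_right_mono order_trans zero_le_power of_nat_0_le_iff)
    have "(\<Sum>i<n. dotp d (v i) (v i)) \<le> (\<Sum>i<n. S)"
    proof (rule sum_mono)
      fix i assume "i \<in> {..<n}"
      then have "(vnorm d (v i))\<^sup>2 \<le> K1\<^sup>2" using v1 by (intro power_mono) auto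
      then show "dotp d (v i) (v i) \<le> S" using S by (simp add: vnorm_power2)
    qed
    then have v2: "(\<Sum>i<n. dotp d (v i) (v i)) \<le> n * S" by simp
    have l1: "\<forall>x. n * \<beta> / sqrt d * vnorm d x \<le> (\<Sum>i<n. \<bar>dotp d (v i) x\<bar>)"
      unfolding \<beta>_def using sum_abs_dotp_ge_of_moments[OF n0 d0 c0 K(1) _ m4'] m2 by blast
    have "prob {\<omega> \<in> space (gauss_vecs d n). exists_sep_W d n (vecs_of \<omega>) v} \<le> exp (- c * real d)"
      using d by (intro D n v2 l1) simp
    moreover have "{\<omega> \<in> space (gauss_vecs d n). exists_sep_W d n (vecs_of \<omega>) v} \<in> events"
      by (intro sets_exists_sep_W measurable_gauss_vecs borel_measurable_const)
    ultimately show "1 - exp (- c * real d) \<le> prob {\<omega> \<in> space (gauss_vecs d n). \<not> exists_sep_W d n (vecs_of \<omega>) v}"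
      by (intro prob_not_ge)
  qed
qed

text \<open>On \<open>G\<close> the sample v meets the two assumptions of the fixed-v bound. The
  first moment bound is transferred from the net: moving x by d^(-2) changes the sum by at most
  d^(-2) \<Sum> |v_i| <= 3 n / d^2, which is the term 3 sqrt(d) / d^2 in units of n /
  sqrt(d).\<close>

lemma gauss_vecs_good_tail:
  fixes \<delta> :: real
  assumes d: "3 \<le> d" and n: "0 < n" and \<delta>: "0 < \<delta>" "\<delta> < 1"
  shows "\<exists>G \<in> sets (gauss_vecs d n).
    (\<forall>\<omega>\<in>G. (\<Sum>i<n. dotp d (vecs_of \<omega> i) (vecs_of \<omega> i)) \<le> n * (1 + \<delta>) \<and>
      (\<forall>x. n * ((1 - \<delta>) * sqrt (2 / pi) * (1 - 1 / real d ^ 2) - 3 * sqrt d / real d ^ 2) / sqrt d * vnorm d x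
         \<le> (\<Sum>i<n. \<bar>dotp d (vecs_of \<omega> i) x\<bar>))) \<and>
    measure (gauss_vecs d n) (space (gauss_vecs d n) - G)
      \<le> real d ^ (4 * d) * exp (- (\<delta>\<^sup>2 / pi) * n) + exp (- ((\<delta> - ln (1 + \<delta>)) / 2) * (real n * real d))"
proof -
  let ?M = "gauss_vecs d n"
  have d0: "0 < d" using d by simp
  interpret prob_space ?M by (rule prob_space_gauss_vecs[OF d0])
  obtain N where N: "finite N" "card N \<le> d ^ (4 * d)" "\<And>y. y \<in> N \<Longrightarrow> 0 < vnorm d y"
    and net: "\<And>x. vnorm d x = 1 \<Longrightarrow> \<exists>y\<in>N. vnorm d (\<lambda>k. x k - y k) \<le> 1 / real d ^ 2"
    using sphere_net[OF d] by blast
  define A where "A y = {\<omega> \<in> space ?M. (\<Sum>j<n. \<bar>dotp d (vecs_of \<omega> j) y\<bar>) \<le> (1 - \<delta>) * sqrt (2 / pi) * n * (vnorm d y / sqrt d)}" for y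
  define E where "E = {\<omega> \<in> space ?M. (1 + \<delta>) * real n \<le> (\<Sum>j<n. dotp d (vecs_of \<omega> j) (vecs_of \<omega> j))}"
  have "(\<lambda>\<omega>. \<Sum>j<n. \<bar>dotp d (vecs_of \<omega> j) y\<bar>) \<in> borel_measurable ?M" for y
    by (intro borel_measurable_sum borel_measurable_abs measurable_dotp_gauss_vecs) simp
  then have Am: "A y \<in> events" for y unfolding A_def by (intro borel_measurable_le borel_measurable_const)
  have "(\<lambda>\<omega>. \<Sum>j<n. dotp d (vecs_of \<omega> j) (vecs_of \<omega> j)) \<in> borel_measurable ?M"
    by (intro borel_measurable_sum measurable_dotp_self_gauss_vecs) simp
  then have Em: "E \<in> events" unfolding E_def by (intro borel_measurable_le borel_measurable_const)
  have UA: "(\<Union>y\<in>N. A y) \<in> events" by (intro sets.finite_UN N(1) Am)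
  define G where "G = space ?M - ((\<Union>y\<in>N. A y) \<union> E)"
  have Gm: "G \<in> events" unfolding G_def by (intro sets.compl_sets sets.Un UA Em)
  have good: "(\<Sum>i<n. dotp d (vecs_of \<omega> i) (vecs_of \<omega> i)) \<le> n * (1 + \<delta>)"
    "n * ((1 - \<delta>) * sqrt (2 / pi) * (1 - 1 / real d ^ 2) - 3 * sqrt d / real d ^ 2) / sqrt d * vnorm d x
         \<le> (\<Sum>i<n. \<bar>dotp d (vecs_of \<omega> i) x\<bar>)" if \<omega>: "\<omega> \<in> G" for \<omega> x
  proof -
    define v where "v = vecs_of \<omega>"
    have \<omega>s: "\<omega> \<in> space ?M" "\<omega> \<notin> E" "\<And>y. y \<in> N \<Longrightarrow> \<omega> \<notin> A y" using \<omega> by (auto simp: G_def)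
    have v2: "(\<Sum>i<n. dotp d (v i) (v i)) \<le> n * (1 + \<delta>)"
      using \<omega>s(1,2) unfolding E_def v_def by (auto simp: mult.commute)
    then show "(\<Sum>i<n. dotp d (vecs_of \<omega> i) (vecs_of \<omega> i)) \<le> n * (1 + \<delta>)" unfolding v_def .
    \<comment> \<open>The sum of squared norms also controls the sum of norms, through 2 a <= 1 +
      a^2; no further event has to be excluded.\<close>
    have "(\<Sum>i<n. vnorm d (v i)) \<le> (\<Sum>i<n. 1 + dotp d (v i) (v i))"
    proof (rule sum_mono)
      fix i
      have "0 \<le> (vnorm d (v i) - 1)\<^sup>2" by simp
      then have "2 * vnorm d (v i) \<le> 1 + (vnorm d (v i))\<^sup>2" unfolding power2_diff by simp
      then show "vnorm d (v i) \<le> 1 + dotp d (v i) (v i)"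
        using vnorm_nonneg[of d "v i"] unfolding vnorm_power2 by linarith
    qed
    also have "\<dots> = n + (\<Sum>i<n. dotp d (v i) (v i))" by (simp add: sum.distrib)
    also have "\<dots> \<le> n * (2 + \<delta>)" using v2 by (simp add: algebra_simps)
    also have "\<dots> \<le> real n * 3" using \<delta> by (intro mult_left_mono) auto
    finally have v1: "(\<Sum>i<n. vnorm d (v i)) \<le> real n * 3" .
    show "n * ((1 - \<delta>) * sqrt (2 / pi) * (1 - 1 / real d ^ 2) - 3 * sqrt d / real d ^ 2) / sqrt d * vnorm d x
         \<le> (\<Sum>i<n. \<bar>dotp d (vecs_of \<omega> i) x\<bar>)"
      unfolding v_def[symmetric]
    proof (rule sum_abs_dotp_ge_of_unit)
      fix x assume x: "vnorm d x = 1"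
      obtain y where y: "y \<in> N" "vnorm d (\<lambda>k. x k - y k) \<le> 1 / real d ^ 2" using net[OF x] by blast
      have "1 - 1 / real d ^ 2 \<le> vnorm d y" using vnorm_le_diff[of d x y] x y by linarith
      then have "(1 - \<delta>) * sqrt (2 / pi) * n * ((1 - 1 / real d ^ 2) / sqrt d) \<le> (1 - \<delta>) * sqrt (2 / pi) * n * (vnorm d y / sqrt d)"
        using \<delta> by (intro divide_right_mono mult_left_mono) auto
      also have "\<dots> \<le> (\<Sum>i<n. \<bar>dotp d (v i) y\<bar>)"
        using \<omega>s(3)[OF y(1)] \<omega>s(1) unfolding A_def v_def by auto
      also have "\<dots> \<le> (\<Sum>i<n. \<bar>dotp d (v i) x\<bar> + vnorm d (v i) * (1 / real d ^ 2))"
      proof (rule sum_mono)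
        fix i
        have "\<bar>dotp d (v i) (\<lambda>k. x k - y k)\<bar> \<le> vnorm d (v i) * vnorm d (\<lambda>k. x k - y k)" by (rule abs_dotp_le)
        also have "\<dots> \<le> vnorm d (v i) * (1 / real d ^ 2)" by (intro mult_left_mono y) simp
        finally show "\<bar>dotp d (v i) y\<bar> \<le> \<bar>dotp d (v i) x\<bar> + vnorm d (v i) * (1 / real d ^ 2)"
          unfolding dotp_diff_right by linarith
      qed
      also have "\<dots> = (\<Sum>i<n. \<bar>dotp d (v i) x\<bar>) + (\<Sum>i<n. vnorm d (v i)) * (1 / real d ^ 2)"
        by (simp add: sum.distrib sum_divide_distrib)
      also have "\<dots> \<le> (\<Sum>i<n. \<bar>dotp d (v i) x\<bar>) + real n * 3 * (1 / real d ^ 2)"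
        using v1 by (intro add_left_mono mult_right_mono) auto
      finally have "(1 - \<delta>) * sqrt (2 / pi) * n * ((1 - 1 / real d ^ 2) / sqrt d) - real n * 3 * (1 / real d ^ 2) \<le> (\<Sum>i<n. \<bar>dotp d (v i) x\<bar>)"
        by linarith
      moreover have "n * ((1 - \<delta>) * sqrt (2 / pi) * (1 - 1 / real d ^ 2) - 3 * sqrt d / real d ^ 2) / sqrt d
         = (1 - \<delta>) * sqrt (2 / pi) * n * ((1 - 1 / real d ^ 2) / sqrt d) - real n * 3 * (1 / real d ^ 2)"
      proof -
        have "N * (B * q - 3 * s / D) / s = B * N * (q / s) - N * 3 * (1 / D)" if "s \<noteq> 0" "D \<noteq> 0" for N B q s D :: real
          using that by (simp add: field_simps)
        then show ?thesis using d0 by simp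
      qed
      ultimately show "n * ((1 - \<delta>) * sqrt (2 / pi) * (1 - 1 / real d ^ 2) - 3 * sqrt d / real d ^ 2) / sqrt d \<le> (\<Sum>i<n. \<bar>dotp d (v i) x\<bar>)"
        by simp
    qed
  qed
  have "space ?M - G = (\<Union>y\<in>N. A y) \<union> E" unfolding G_def A_def E_def by blast
  then have "prob (space ?M - G) \<le> prob (\<Union>y\<in>N. A y) + prob E"
    using measure_Un_le[OF UA Em] by simp
  moreover have "prob (\<Union>y\<in>N. A y) \<le> real d ^ (4 * d) * exp (- (\<delta>\<^sup>2 / pi) * n)"
  proof -
    have "prob (\<Union>y\<in>N. A y) \<le> (\<Sum>y\<in>N. prob (A y))"
      by (intro measure_UNION_le N(1) Am)
    also have "\<dots> \<le> (\<Sum>y\<in>N. exp (- (\<delta>\<^sup>2 / pi) * n))"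
      unfolding A_def by (intro sum_mono gauss_vecs_abs_tail d0 \<delta> N)
    also have "\<dots> = real (card N) * exp (- (\<delta>\<^sup>2 / pi) * n)" by simp
    also have "\<dots> \<le> real d ^ (4 * d) * exp (- (\<delta>\<^sup>2 / pi) * n)"
      using N(2) by (intro mult_right_mono) (auto simp flip: of_nat_power)
    finally show ?thesis .
  qed
  moreover have "prob E \<le> exp (- ((\<delta> - ln (1 + \<delta>)) / 2) * (real n * real d))"
    using gauss_vecs_norm_tail[OF d0 order_refl \<delta>(1), of n] unfolding E_def by simp
  ultimately have "prob (space ?M - G) \<le> real d ^ (4 * d) * exp (- (\<delta>\<^sup>2 / pi) * n) + exp (- ((\<delta> - ln (1 + \<delta>)) / 2) * (real n * real d))"
    by linarith
  with Gm good show ?thesis by blast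
qed

text \<open>Fubini: sections over \<open>G\<close> have measure at most e, the remaining ones at
  most 1. In the application the first factor carries u and the second v, so v is frozen in a good
  state.\<close>

lemma measure_pair_le:
  assumes "prob_space M1" "prob_space M2"
    and X: "X \<in> sets (M1 \<Otimes>\<^sub>M M2)" and G: "G \<in> sets M2"
    and sec: "\<And>y. y \<in> G \<Longrightarrow> measure M1 ((\<lambda>x. (x, y)) -` X) \<le> e" and e: "0 \<le> e"
  shows "measure (M1 \<Otimes>\<^sub>M M2) X \<le> e + measure M2 (space M2 - G)"
proof -
  interpret M1: prob_space M1 by fact
  interpret M2: prob_space M2 by fact
  interpret P: pair_prob_space M1 M2 ..
  have "emeasure (M1 \<Otimes>\<^sub>M M2) X = (\<integral>\<^sup>+y. emeasure M1 ((\<lambda>x. (x, y)) -` X) \<partial>M2)"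
    by (rule P.emeasure_pair_measure_alt2[OF X])
  also have "\<dots> \<le> (\<integral>\<^sup>+y. ennreal e + indicator (space M2 - G) y \<partial>M2)"
  proof (rule nn_integral_mono)
    fix y assume y: "y \<in> space M2"
    show "emeasure M1 ((\<lambda>x. (x, y)) -` X) \<le> ennreal e + indicator (space M2 - G) y"
    proof (cases "y \<in> G")
      case True
      then show ?thesis using sec[OF True] by (simp add: M1.emeasure_eq_measure ennreal_leI)
    next
      case False
      have "emeasure M1 ((\<lambda>x. (x, y)) -` X) \<le> 1" by (rule M1.measure_le_1)
      also have "\<dots> \<le> ennreal e + indicator (space M2 - G) y" using False y by simp
      finally show ?thesis .
    qed
  qed
  also have "\<dots> = ennreal e + emeasure M2 (space M2 - G)"
    using G by (subst nn_integral_add) (auto simp: M2.emeasure_space_1)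
  also have "\<dots> = ennreal (e + measure M2 (space M2 - G))"
    using e by (simp add: M2.emeasure_eq_measure ennreal_plus)
  finally have "ennreal (P.prob X) \<le> ennreal (e + measure M2 (space M2 - G))"
    by (simp only: P.emeasure_eq_measure)
  then show ?thesis
    using e by (subst (asm) ennreal_le_iff) auto
qed

lemma no_separating_matrix_gaussian_design:
  fixes \<epsilon> :: real
  assumes \<epsilon>: "0 < \<epsilon>"
  shows "\<exists>c>0. \<exists>D::nat. \<forall>d\<ge>D. \<forall>n::nat.
            real n \<ge> (pi / 4 + \<epsilon>) * real d ^ 2 / ln (real d) \<longrightarrow>
            measure (gauss_vecs d n \<Otimes>\<^sub>M gauss_vecs d n)
              {\<omega> \<in> space (gauss_vecs d n \<Otimes>\<^sub>M gauss_vecs d n).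
                 \<not> exists_sep_W d n (vecs_of (fst \<omega>)) (vecs_of (snd \<omega>))}
            \<ge> 1 - exp (- c * real d)"
proof -
  define \<gamma> where "\<gamma> = pi / 4 + \<epsilon>"
  have \<gamma>: "0 < \<gamma>" using \<epsilon> by (simp add: \<gamma>_def add_pos_pos)
  \<comment> \<open>At \<delta> = 0 the inequality reads 1 < 1 + 4 \<epsilon> / pi, which is 2 (2 /
    pi) (pi / 4 + \<epsilon>) > 1: this is where the constant pi / 4 arises. By continuity it
    survives for small \<delta> > 0.\<close>
  have "\<exists>\<delta>::real. 0 < \<delta> \<and> \<delta> < 1/4 \<and> 1 + \<delta> < (1 - 2 * \<delta>)\<^sup>2 * (1 + 4 * \<epsilon> / pi)"
  proof -
    have "((\<lambda>\<delta>::real. (1 - 2 * \<delta>)\<^sup>2 * (1 + 4 * \<epsilon> / pi) - (1 + \<delta>)) \<longlongrightarrow> (1 - 2 * 0)\<^sup>2 * (1 + 4 * \<epsilon> / pi) - (1 + 0)) (at_right 0)"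
      by (intro tendsto_intros)
    moreover have "0 < (1 - 2 * 0)\<^sup>2 * (1 + 4 * \<epsilon> / pi) - (1 + 0)" using \<epsilon> by simp
    ultimately have "\<forall>\<^sub>F \<delta> in at_right (0::real). 0 < (1 - 2 * \<delta>)\<^sup>2 * (1 + 4 * \<epsilon> / pi) - (1 + \<delta>)"
      by (rule order_tendstoD)
    moreover have "\<forall>\<^sub>F \<delta> in at_right (0::real). \<delta> \<in> {0<..<1/4}"
      by (rule eventually_at_right_real) simp
    ultimately have "\<forall>\<^sub>F \<delta> in at_right (0::real). 0 < \<delta> \<and> \<delta> < 1/4 \<and> 1 + \<delta> < (1 - 2 * \<delta>)\<^sup>2 * (1 + 4 * \<epsilon> / pi)"
      by eventually_elim auto
    then show ?thesis by (rule eventually_happens'[rotated]) simp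
  qed
  then obtain \<delta> :: real where \<delta>: "0 < \<delta>" "\<delta> < 1/4" "1 + \<delta> < (1 - 2 * \<delta>)\<^sup>2 * (1 + 4 * \<epsilon> / pi)" by blast
  \<comment> \<open>The good set supplies (1 - \<delta>) sqrt(2 / pi) up to vanishing net errors;
    the second \<delta> absorbs these errors for large d.\<close>
  define \<beta> where "\<beta> = (1 - 2 * \<delta>) * sqrt (2 / pi)"
  have \<beta>: "0 < \<beta>" using \<delta> by (simp add: \<beta>_def)
  have "2 * \<beta>\<^sup>2 * \<gamma> = (1 - 2 * \<delta>)\<^sup>2 * (1 + 4 * \<epsilon> / pi)"
  proof -
    have "\<beta>\<^sup>2 = (1 - 2 * \<delta>)\<^sup>2 * (2 / pi)" by (simp add: \<beta>_def power_mult_distrib)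
    moreover have "2 * (q * (2 / pi)) * (pi / 4 + \<epsilon>) = q * (1 + 4 * \<epsilon> / pi)" for q
      by (simp add: field_simps)
    ultimately show ?thesis by (simp only: \<gamma>_def)
  qed
  then have "1 + \<delta> < 2 * \<beta>\<^sup>2 * \<gamma>" using \<delta> by simp
  have "0 < 1 + \<delta>" using \<delta> by simp
  from prob_exists_sep_W_asymp[OF \<gamma> \<beta> this \<open>1 + \<delta> < 2 * \<beta>\<^sup>2 * \<gamma>\<close>] obtain c1 D1 where c1: "0 < c1"
    and D1: "\<And>d n v. D1 \<le> d \<Longrightarrow> \<gamma> * real d ^ 2 / ln (real d) \<le> real n \<Longrightarrow>
      (\<Sum>i<n. dotp d (v i) (v i)) \<le> n * (1 + \<delta>) \<Longrightarrow>
      (\<forall>x. n * \<beta> / sqrt d * vnorm d x \<le> (\<Sum>i<n. \<bar>dotp d (v i) x\<bar>)) \<Longrightarrow>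
      measure (gauss_vecs d n) {\<omega> \<in> space (gauss_vecs d n). exists_sep_W d n (vecs_of \<omega>) v} \<le> exp (- c1 * real d)"
    by blast
  define \<kappa> where "\<kappa> = (\<delta> - ln (1 + \<delta>)) / 2"
  have \<kappa>: "0 < \<kappa>" using ln_add_one_self_less_self[OF \<delta>(1)] by (simp add: \<kappa>_def)
  define c where "c = min c1 (min \<kappa> 1) / 2"
  have c: "0 < c" "2 * c \<le> c1" "2 * c \<le> \<kappa>" "2 * c \<le> 1" using c1 \<kappa> by (auto simp: c_def)
  \<comment> \<open>At the threshold, n \<delta>^2 / pi is at least g d^2 / ln d, which outgrows the
    logarithm 4 d ln d of the bound on the net size.\<close>
  define g where "g = \<delta>\<^sup>2 / pi * \<gamma>"
  have g: "0 < g" using \<delta> \<gamma> by (simp add: g_def)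
  have "\<forall>\<^sub>F x::real in at_top. \<beta> < (1 - \<delta>) * sqrt (2 / pi) * (1 - 1 / x ^ 2) - 3 * sqrt x / x ^ 2"
  proof -
    define b where "b = (1 - \<delta>) * sqrt (2 / pi)"
    have "((\<lambda>x::real. b * (1 - 1 / x ^ 2) - 3 * sqrt x / x ^ 2) \<longlongrightarrow> b) at_top"
      by real_asymp
    moreover have "\<beta> < b" unfolding b_def \<beta>_def using \<delta> by (intro mult_strict_right_mono) auto
    ultimately show ?thesis unfolding b_def by (rule order_tendstoD(1))
  qed
  moreover have "\<forall>\<^sub>F x::real in at_top. 4 * x * ln x - g * (x ^ 2 / ln x) \<le> - x" using g by real_asymp
  moreover have "\<forall>\<^sub>F x::real in at_top. 3 \<le> exp (c * x)" using c by real_asymp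
  moreover have "\<forall>\<^sub>F x::real in at_top. 3 \<le> x" by (rule eventually_ge_at_top)
  ultimately have "\<forall>\<^sub>F x::real in at_top. \<beta> < (1 - \<delta>) * sqrt (2 / pi) * (1 - 1 / x ^ 2) - 3 * sqrt x / x ^ 2 \<and>
     4 * x * ln x - g * (x ^ 2 / ln x) \<le> - x \<and> 3 \<le> exp (c * x) \<and> 3 \<le> x"
    by eventually_elim blast
  then have "\<forall>\<^sub>F d in sequentially. \<beta> < (1 - \<delta>) * sqrt (2 / pi) * (1 - 1 / real d ^ 2) - 3 * sqrt (real d) / real d ^ 2 \<and>
     4 * real d * ln (real d) - g * (real d ^ 2 / ln (real d)) \<le> - real d \<and> 3 \<le> exp (c * real d) \<and> 3 \<le> real d"
    by (rule eventually_compose_filterlim) (rule filterlim_real_sequentially)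
  then obtain D2 where D2: "\<And>d. D2 \<le> d \<Longrightarrow> \<beta> < (1 - \<delta>) * sqrt (2 / pi) * (1 - 1 / real d ^ 2) - 3 * sqrt (real d) / real d ^ 2 \<and>
     4 * real d * ln (real d) - g * (real d ^ 2 / ln (real d)) \<le> - real d \<and> 3 \<le> exp (c * real d) \<and> 3 \<le> real d"
    unfolding eventually_sequentially by blast
  show ?thesis
    unfolding \<gamma>_def[symmetric]
  proof (rule exI[of _ c], rule conjI[OF c(1)], rule exI[of _ "max D1 D2"], intro allI impI)
    fix d n :: nat
    assume d: "max D1 D2 \<le> d" and n: "\<gamma> * real d ^ 2 / ln (real d) \<le> real n"
    have b: "\<beta> < (1 - \<delta>) * sqrt (2 / pi) * (1 - 1 / real d ^ 2) - 3 * sqrt (real d) / real d ^ 2"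
      and e1: "4 * real d * ln (real d) - g * (real d ^ 2 / ln (real d)) \<le> - real d"
      and e2: "3 \<le> exp (c * real d)" and d3: "3 \<le> d"
      using D2[of d] d by auto
    have d0: "0 < d" using d3 by simp
    have n0: "0 < n" using threshold_pos[OF \<gamma> _ n] d3 by simp
    let ?M = "gauss_vecs d n"
    let ?bad = "{\<omega> \<in> space (?M \<Otimes>\<^sub>M ?M). exists_sep_W d n (vecs_of (fst \<omega>)) (vecs_of (snd \<omega>))}"
    have M: "prob_space ?M" by (rule prob_space_gauss_vecs[OF d0])
    interpret M: prob_space ?M by (rule M)
    interpret P: pair_prob_space ?M ?M ..
    have bad: "?bad \<in> sets (?M \<Otimes>\<^sub>M ?M)"
      by (intro sets_exists_sep_W measurable_compose[OF measurable_fst measurable_gauss_vecs]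
          measurable_compose[OF measurable_snd measurable_gauss_vecs])
    obtain G where G: "G \<in> sets ?M"
      and G1: "\<And>\<omega>. \<omega> \<in> G \<Longrightarrow> (\<Sum>i<n. dotp d (vecs_of \<omega> i) (vecs_of \<omega> i)) \<le> n * (1 + \<delta>)"
      and G2: "\<And>\<omega> x. \<omega> \<in> G \<Longrightarrow> n * ((1 - \<delta>) * sqrt (2 / pi) * (1 - 1 / real d ^ 2) - 3 * sqrt d / real d ^ 2) / sqrt d * vnorm d x
         \<le> (\<Sum>i<n. \<bar>dotp d (vecs_of \<omega> i) x\<bar>)"
      and G3: "measure ?M (space ?M - G)
      \<le> real d ^ (4 * d) * exp (- (\<delta>\<^sup>2 / pi) * n) + exp (- ((\<delta> - ln (1 + \<delta>)) / 2) * (real n * real d))"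
      using gauss_vecs_good_tail[OF d3 n0 \<delta>(1)] \<delta>(2) by auto
    have sec: "measure ?M ((\<lambda>x. (x, y)) -` ?bad) \<le> exp (- c1 * real d)" if y: "y \<in> G" for y
    proof -
      have "y \<in> space ?M" using y G sets.sets_into_space by blast
      then have "(\<lambda>x. (x, y)) -` ?bad = {\<omega> \<in> space ?M. exists_sep_W d n (vecs_of \<omega>) (vecs_of y)}"
        by (auto simp: space_pair_measure)
      also have "measure ?M \<dots> \<le> exp (- c1 * real d)"
      proof (rule D1[OF _ n G1[OF y]])
        show "D1 \<le> d" using d by simp
        show "\<forall>x. n * \<beta> / sqrt d * vnorm d x \<le> (\<Sum>i<n. \<bar>dotp d (vecs_of y i) x\<bar>)"
        proof
          fix x
          have "n * \<beta> / sqrt d * vnorm d x \<le> n * ((1 - \<delta>) * sqrt (2 / pi) * (1 - 1 / real d ^ 2) - 3 * sqrt d / real d ^ 2) / sqrt d * vnorm d x"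
            using b by (intro mult_right_mono divide_right_mono mult_left_mono) auto
          also have "\<dots> \<le> (\<Sum>i<n. \<bar>dotp d (vecs_of y i) x\<bar>)" by (rule G2[OF y])
          finally show "n * \<beta> / sqrt d * vnorm d x \<le> (\<Sum>i<n. \<bar>dotp d (vecs_of y i) x\<bar>)" .
        qed
      qed
      finally show ?thesis .
    qed
    have "measure (?M \<Otimes>\<^sub>M ?M) ?bad \<le> exp (- c1 * real d) + measure ?M (space ?M - G)"
      by (rule measure_pair_le[OF M M bad G sec]) simp_all
    also have "\<dots> \<le> exp (- c1 * real d) + (real d ^ (4 * d) * exp (- (\<delta>\<^sup>2 / pi) * n) + exp (- \<kappa> * (real n * real d)))"
      using G3 unfolding \<kappa>_def by (rule add_left_mono)
    also have "\<dots> \<le> exp (- 2 * c * real d) + (exp (- 2 * c * real d) + exp (- 2 * c * real d))"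
    proof (intro add_mono)
      have "2 * c * real d \<le> c1 * real d" using c by (intro mult_right_mono) auto
      then show "exp (- c1 * real d) \<le> exp (- 2 * c * real d)" by simp
      have "1 * real d \<le> real n * real d" using n0 by (intro mult_right_mono) auto
      then have "2 * c * real d \<le> \<kappa> * (real n * real d)"
        using c \<kappa> by (intro mult_mono) auto
      then show "exp (- \<kappa> * (real n * real d)) \<le> exp (- 2 * c * real d)" by simp
      have "g * (real d ^ 2 / ln (real d)) = \<delta>\<^sup>2 / pi * (\<gamma> * real d ^ 2 / ln (real d))" by (simp add: g_def)
      also have "\<dots> \<le> \<delta>\<^sup>2 / pi * n" using n by (intro mult_left_mono) auto
      finally have "4 * real d * ln (real d) - \<delta>\<^sup>2 / pi * n \<le> - real d" using e1 by linarith
      also have "\<dots> \<le> - (2 * c) * real d" using c mult_right_mono[of "2 * c" 1 "real d"] by simp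
      finally have le: "4 * real d * ln (real d) - \<delta>\<^sup>2 / pi * n \<le> - 2 * c * real d" by simp
      have "real d ^ (4 * d) = real d powr (real (4 * d))" using d0 by (subst powr_realpow) auto
      also have "\<dots> = exp (4 * real d * ln (real d))" using d0 by (simp add: powr_def)
      finally have "real d ^ (4 * d) * exp (- (\<delta>\<^sup>2 / pi) * n) = exp (4 * real d * ln (real d) - \<delta>\<^sup>2 / pi * n)"
        by (simp add: exp_diff exp_minus divide_inverse)
      also have "\<dots> \<le> exp (- 2 * c * real d)" using le by simp
      finally show "real d ^ (4 * d) * exp (- (\<delta>\<^sup>2 / pi) * n) \<le> exp (- 2 * c * real d)" .
    qed
    also have "\<dots> = 3 * (exp (- c * real d) * exp (- c * real d))"
      by (simp add: exp_add[symmetric])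
    also have "\<dots> \<le> exp (c * real d) * (exp (- c * real d) * exp (- c * real d))"
      using e2 by (intro mult_right_mono) auto
    also have "\<dots> = exp (- c * real d)" by (simp add: exp_add[symmetric])
    finally show "1 - exp (- c * real d) \<le> measure (?M \<Otimes>\<^sub>M ?M)
        {\<omega> \<in> space (?M \<Otimes>\<^sub>M ?M). \<not> exists_sep_W d n (vecs_of (fst \<omega>)) (vecs_of (snd \<omega>))}"
      by (rule P.prob_not_ge[OF bad])
  qed
qed

theorem theorem2p3:
  shows "(\<forall>\<epsilon>>0. \<exists>c>0. \<exists>D::nat. \<forall>d\<ge>D. \<forall>n::nat.
            real n \<ge> (pi / 4 + \<epsilon>) * real d ^ 2 / ln (real d) \<longrightarrow>
            measure (gauss_vecs d n \<Otimes>\<^sub>M gauss_vecs d n)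
              {\<omega> \<in> space (gauss_vecs d n \<Otimes>\<^sub>M gauss_vecs d n).
                 \<not> exists_sep_W d n (vecs_of (fst \<omega>)) (vecs_of (snd \<omega>))}
            \<ge> 1 - exp (- c * real d))
      \<and>
      (\<forall>K1 K2 c0::real. c0 > 0 \<longrightarrow>
         (\<exists>C. \<exists>c>0. \<exists>D::nat. \<forall>d\<ge>D. \<forall>n::nat. \<forall>v :: nat \<Rightarrow> nat \<Rightarrow> real.
            real n \<ge> C * real d ^ 2 / ln (real d) \<longrightarrow>
            (\<forall>i<n. \<exists>k<d. v i k \<noteq> 0) \<longrightarrow>
            (\<forall>i<n. vnorm d (v i) \<le> K1) \<longrightarrow>
            (\<forall>x. (1 / real n) * (\<Sum>i<n. (dotp d (v i) x) ^ 2) \<ge> (c0 / real d) * dotp d x x) \<longrightarrow>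
            tensor4_norm d n v \<le> K2 / real d ^ 2 \<longrightarrow>
            measure (gauss_vecs d n)
              {\<omega> \<in> space (gauss_vecs d n). \<not> exists_sep_W d n (vecs_of \<omega>) v}
            \<ge> 1 - exp (- c * real d)))"
proof (intro conjI allI impI)
  show "\<exists>c>0. \<exists>D::nat. \<forall>d\<ge>D. \<forall>n::nat.
            real n \<ge> (pi / 4 + \<epsilon>) * real d ^ 2 / ln (real d) \<longrightarrow>
            measure (gauss_vecs d n \<Otimes>\<^sub>M gauss_vecs d n)
              {\<omega> \<in> space (gauss_vecs d n \<Otimes>\<^sub>M gauss_vecs d n).
                 \<not> exists_sep_W d n (vecs_of (fst \<omega>)) (vecs_of (snd \<omega>))}
            \<ge> 1 - exp (- c * real d)" if "0 < \<epsilon>" for \<epsilon> :: real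
    using that by (rule no_separating_matrix_gaussian_design)
next
  fix K1 K2 c0 :: real
  assume "0 < c0"
  from no_separating_matrix_fixed_design[OF this, of K1 K2] show "\<exists>C. \<exists>c>0. \<exists>D::nat. \<forall>d\<ge>D. \<forall>n::nat. \<forall>v :: nat \<Rightarrow> nat \<Rightarrow> real.
            real n \<ge> C * real d ^ 2 / ln (real d) \<longrightarrow>
            (\<forall>i<n. \<exists>k<d. v i k \<noteq> 0) \<longrightarrow>
            (\<forall>i<n. vnorm d (v i) \<le> K1) \<longrightarrow>
            (\<forall>x. (1 / real n) * (\<Sum>i<n. (dotp d (v i) x) ^ 2) \<ge> (c0 / real d) * dotp d x x) \<longrightarrow>
            tensor4_norm d n v \<le> K2 / real d ^ 2 \<longrightarrow>
            measure (gauss_vecs d n)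
              {\<omega> \<in> space (gauss_vecs d n). \<not> exists_sep_W d n (vecs_of \<omega>) v}
            \<ge> 1 - exp (- c * real d)"
    by blast
qed

end
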